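(* For any $n\in\mathbb{Z}_{>0}$ and any $r\in\left(0,\arccos\left(\frac{-1}{n+1}\right)\right]$, the Vietoris-Rips complex $\mathrm{VR}_r(\mathbb{S}^n)$ is homotopy equivalent to $\mathbb{S}^n$.
   Context: $\mathbb{S}^n$ is the unit sphere in $\mathbb{R}^{n+1}$ with its geodesic (angular) distance, so its diameter is $\pi$. For a metric space $X$ and $r>0$, $\mathrm{VR}_r(X)$ is (the geometric realization of) the simplicial complex whose vertices are the points of $X$ and whose simplices are the nonempty finite subsets of $X$ of diameter strictly less than $r$. *)

theory Defs
  imports "HOL-Analysis.Analysis"
begin

section \<open>Vietoris-Rips complexes\<close>

text \<open>
  An abstract simplicial complex is represented by its set of (nonempty, finite) simplices.
\<close>

definition abstract_simplicial_complex :: "'v set set \<Rightarrow> bool" where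
  "abstract_simplicial_complex K \<longleftrightarrow>
     (\<forall>\<sigma>\<in>K. finite \<sigma> \<and> \<sigma> \<noteq> {} \<and> (\<forall>\<tau>. \<tau> \<subseteq> \<sigma> \<and> \<tau> \<noteq> {} \<longrightarrow> \<tau> \<in> K))"

text \<open>
  This is \<^const>\<open>diameter\<close>, which exists only for the type class of metric spaces,
  for an arbitrary \<^typ>\<open>'a metric\<close>.
\<close>

definition mdiameter :: "'a metric \<Rightarrow> 'a set \<Rightarrow> real" where
  "mdiameter m S = (if S = {} then 0 else SUP (x,y)\<in>S\<times>S. mdist m x y)"

definition vietoris_rips :: "real \<Rightarrow> 'a metric \<Rightarrow> 'a set set" where
  "vietoris_rips r m = {\<sigma>. \<sigma> \<noteq> {} \<and> finite \<sigma> \<and> \<sigma> \<subseteq> mspace m \<and> mdiameter m \<sigma> < r}"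

lemma mdiameter_less_iff:
  assumes "finite S" "S \<noteq> {}"
  shows "mdiameter m S < r \<longleftrightarrow> (\<forall>x\<in>S. \<forall>y\<in>S. mdist m x y < r)"
proof -
  let ?D = "(\<lambda>(x,y). mdist m x y) ` (S \<times> S)"
  have D: "finite ?D" "?D \<noteq> {}"
    using assms by (blast intro: finite_imageI finite_cartesian_product)+
  have "mdiameter m S = Max ?D"
    using assms cSup_eq_Max[OF D] by (simp only: mdiameter_def if_False)
  then have "mdiameter m S < r \<longleftrightarrow> (\<forall>d\<in>?D. d < r)"
    using Max_less_iff[OF D] by (simp only:)
  then show ?thesis
    by auto
qed

lemma abstract_simplicial_complex_vietoris_rips:
  "abstract_simplicial_complex (vietoris_rips r m)"
proof -
  have "\<tau> \<in> vietoris_rips r m"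
    if "\<sigma> \<in> vietoris_rips r m" "\<tau> \<subseteq> \<sigma>" "\<tau> \<noteq> {}" for \<sigma> \<tau>
  proof -
    have "finite \<sigma>" "\<sigma> \<noteq> {}" "\<sigma> \<subseteq> mspace m" "mdiameter m \<sigma> < r"
      using that(1) by (auto simp: vietoris_rips_def)
    moreover have "finite \<tau>"
      using \<open>finite \<sigma>\<close> that(2) finite_subset by blast
    moreover have "mdiameter m \<tau> < r"
      using calculation that(2,3) mdiameter_less_iff[of \<sigma> m r] mdiameter_less_iff[of \<tau> m r] by blast
    ultimately show ?thesis
      using that(2,3) unfolding vietoris_rips_def by blast
  qed
  moreover have "finite \<sigma> \<and> \<sigma> \<noteq> {}" if "\<sigma> \<in> vietoris_rips r m" for \<sigma>
    using that by (simp add: vietoris_rips_def)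
  ultimately show ?thesis
    unfolding abstract_simplicial_complex_def by blast
qed


section \<open>Geometric realization\<close>

text \<open>
  Points of the realization are given by their barycentric coordinates.  The closed
  simplex on a finite vertex set \<open>\<sigma>\<close> carries the Euclidean topology, obtained here as the subspace
  topology of the product topology (all coordinates outside \<open>\<sigma>\<close> are constantly zero), and the
  realization carries the weak topology with respect to its closed simplices.  For complexes that
  are not locally finite this is finer than the subspace topology of the product.
\<close>

definition closed_simplex :: "'v set \<Rightarrow> ('v \<Rightarrow> real) set" where
  "closed_simplex \<sigma> = {f. (\<forall>v. 0 \<le> f v) \<and> (\<forall>v. v \<notin> \<sigma> \<longrightarrow> f v = 0) \<and> (\<Sum>v\<in>\<sigma>. f v) = 1}"

definition simplex_topology :: "'v set \<Rightarrow> ('v \<Rightarrow> real) topology" where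
  "simplex_topology \<sigma> = subtopology (powertop_real UNIV) (closed_simplex \<sigma>)"

definition geometric_realization :: "'v set set \<Rightarrow> ('v \<Rightarrow> real) topology" where
  "geometric_realization K =
     topology (\<lambda>U. U \<subseteq> (\<Union>\<sigma>\<in>K. closed_simplex \<sigma>) \<and>
                   (\<forall>\<sigma>\<in>K. openin (simplex_topology \<sigma>) (U \<inter> closed_simplex \<sigma>)))"

lemma topspace_simplex_topology [simp]: "topspace (simplex_topology \<sigma>) = closed_simplex \<sigma>"
  by (simp add: simplex_topology_def)

lemma openin_geometric_realization:
  "openin (geometric_realization K) U \<longleftrightarrow>
     U \<subseteq> (\<Union>\<sigma>\<in>K. closed_simplex \<sigma>) \<and>
     (\<forall>\<sigma>\<in>K. openin (simplex_topology \<sigma>) (U \<inter> closed_simplex \<sigma>))"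
proof -
  let ?L = "\<lambda>U. U \<subseteq> (\<Union>\<sigma>\<in>K. closed_simplex \<sigma>) \<and>
                (\<forall>\<sigma>\<in>K. openin (simplex_topology \<sigma>) (U \<inter> closed_simplex \<sigma>))"
  have "istopology ?L"
    unfolding istopology_def
  proof (intro conjI allI impI)
    fix S T assume S: "?L S" and T: "?L T"
    show "S \<inter> T \<subseteq> (\<Union>\<sigma>\<in>K. closed_simplex \<sigma>)"
      using S by blast
    show "\<forall>\<sigma>\<in>K. openin (simplex_topology \<sigma>) (S \<inter> T \<inter> closed_simplex \<sigma>)"
    proof
      fix \<sigma> assume "\<sigma> \<in> K"
      then have "openin (simplex_topology \<sigma>) ((S \<inter> closed_simplex \<sigma>) \<inter> (T \<inter> closed_simplex \<sigma>))"
        using S T by blast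
      moreover have "(S \<inter> closed_simplex \<sigma>) \<inter> (T \<inter> closed_simplex \<sigma>) = S \<inter> T \<inter> closed_simplex \<sigma>"
        by blast
      ultimately show "openin (simplex_topology \<sigma>) (S \<inter> T \<inter> closed_simplex \<sigma>)"
        by simp
    qed
  next
    fix \<K> assume L: "\<forall>U\<in>\<K>. ?L U"
    then show "\<Union>\<K> \<subseteq> (\<Union>\<sigma>\<in>K. closed_simplex \<sigma>)"
      by blast
    show "\<forall>\<sigma>\<in>K. openin (simplex_topology \<sigma>) (\<Union>\<K> \<inter> closed_simplex \<sigma>)"
    proof
      fix \<sigma> assume "\<sigma> \<in> K"
      then have "openin (simplex_topology \<sigma>) (\<Union>U\<in>\<K>. U \<inter> closed_simplex \<sigma>)"
        using L by (intro openin_Union) blast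
      then show "openin (simplex_topology \<sigma>) (\<Union>\<K> \<inter> closed_simplex \<sigma>)"
        by (simp only: Int_Union2)
    qed
  qed
  then show ?thesis
    by (simp add: geometric_realization_def)
qed

lemma topspace_geometric_realization [simp]:
  "topspace (geometric_realization K) = (\<Union>\<sigma>\<in>K. closed_simplex \<sigma>)"
proof (rule subset_antisym)
  show "topspace (geometric_realization K) \<subseteq> (\<Union>\<sigma>\<in>K. closed_simplex \<sigma>)"
    using openin_geometric_realization openin_topspace by blast
  have "(\<Union>\<sigma>\<in>K. closed_simplex \<sigma>) \<inter> closed_simplex \<tau> = closed_simplex \<tau>" if "\<tau> \<in> K" for \<tau>
    using that by blast
  then have "openin (geometric_realization K) (\<Union>\<sigma>\<in>K. closed_simplex \<sigma>)"
    unfolding openin_geometric_realization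
    using openin_topspace[of "simplex_topology \<tau>" for \<tau> :: "'a set"] by simp
  then show "(\<Union>\<sigma>\<in>K. closed_simplex \<sigma>) \<subseteq> topspace (geometric_realization K)"
    by (rule openin_subset)
qed


section \<open>The unit sphere with its geodesic distance\<close>

text \<open>
  \<^const>\<open>arccos\<close> is unspecified outside the interval from -1 to 1, whereas
  \<^locale>\<open>Metric_space\<close> demands a distance that is nonnegative everywhere.  Hence the case
  distinction, whose second branch is never relevant.
\<close>

definition geodesic_dist :: "'a::euclidean_space \<Rightarrow> 'a \<Rightarrow> real" where
  "geodesic_dist x y =
     (if x \<in> sphere 0 1 \<and> y \<in> sphere 0 1 then arccos (x \<bullet> y) else 0)"

definition geodesic_sphere :: "'a::euclidean_space metric" where
  "geodesic_sphere = metric (sphere 0 1, geodesic_dist)"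

lemma inner_sphere_bounds:
  fixes x y :: "'a::euclidean_space"
  assumes "x \<in> sphere 0 1" "y \<in> sphere 0 1"
  shows "- 1 \<le> x \<bullet> y" "x \<bullet> y \<le> 1"
  using Cauchy_Schwarz_ineq2[of x y] assms by auto

lemma geodesic_dist_cos:
  fixes x y :: "'a::euclidean_space"
  assumes "x \<in> sphere 0 1" "y \<in> sphere 0 1"
  shows "0 \<le> geodesic_dist x y" "geodesic_dist x y \<le> pi" "cos (geodesic_dist x y) = x \<bullet> y"
  using inner_sphere_bounds[OF assms] assms
  by (auto simp: geodesic_dist_def arccos_lbound arccos_ubound)

lemma dist_sphere_power2:
  fixes x y :: "'a::euclidean_space"
  assumes "x \<in> sphere 0 1" "y \<in> sphere 0 1"
  shows "(dist x y)\<^sup>2 = 2 - 2 * (x \<bullet> y)"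
proof -
  have "x \<bullet> x = 1" "y \<bullet> y = 1"
    using assms by (auto simp: dot_square_norm)
  then show ?thesis
    by (simp add: dist_norm power2_norm_eq_inner inner_diff_left inner_diff_right inner_commute)
qed

lemma geodesic_dist_triangle:
  fixes x y z :: "'a::euclidean_space"
  assumes x: "x \<in> sphere 0 1" and y: "y \<in> sphere 0 1" and z: "z \<in> sphere 0 1"
  shows "geodesic_dist x z \<le> geodesic_dist x y + geodesic_dist y z"
proof (cases "geodesic_dist x y + geodesic_dist y z \<le> pi")
  case False
  then show ?thesis
    using geodesic_dist_cos(2)[OF x z] by linarith
next
  case True
  define a b where "a = geodesic_dist x y" and "b = geodesic_dist y z"
  note a = geodesic_dist_cos[OF x y, folded a_def]
  note b = geodesic_dist_cos[OF y z, folded b_def]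
  have sq: "x \<bullet> x = 1" "y \<bullet> y = 1" "z \<bullet> z = 1"
    using x y z by (auto simp: dot_square_norm)
  define u w where "u = x - cos a *\<^sub>R y" and "w = z - cos b *\<^sub>R y"
  have "u \<bullet> u = 1 - (cos a)\<^sup>2"
    by (simp add: u_def inner_diff_left inner_diff_right sq a(3)
        inner_commute power2_eq_square)
  then have "(norm u)\<^sup>2 = (sin a)\<^sup>2"
    by (simp add: power2_norm_eq_inner sin_squared_eq)
  then have u: "norm u = sin a"
    using sin_ge_zero[OF a(1,2)] by (simp add: power2_eq_iff_nonneg)
  have "w \<bullet> w = 1 - (cos b)\<^sup>2"
    by (simp add: w_def inner_diff_left inner_diff_right sq b(3)
        inner_commute power2_eq_square)
  then have "(norm w)\<^sup>2 = (sin b)\<^sup>2"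
    by (simp add: power2_norm_eq_inner sin_squared_eq)
  then have w: "norm w = sin b"
    using sin_ge_zero[OF b(1,2)] by (simp add: power2_eq_iff_nonneg)
  have "u \<bullet> w = x \<bullet> z - cos a * cos b"
    by (simp add: u_def w_def inner_diff_left inner_diff_right sq a(3) b(3)
        inner_commute algebra_simps)
  moreover have "\<bar>u \<bullet> w\<bar> \<le> sin a * sin b"
    using Cauchy_Schwarz_ineq2[of u w] u w by simp
  ultimately have "cos (a + b) \<le> cos (geodesic_dist x z)"
    unfolding cos_add geodesic_dist_cos(3)[OF x z] by linarith
  then have "geodesic_dist x z \<le> a + b"
    using True a(1) b(1) geodesic_dist_cos[OF x z] unfolding a_def[symmetric] b_def[symmetric]
    by (subst (asm) cos_mono_le_eq) auto
  then show ?thesis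
    by (simp add: a_def b_def)
qed

lemma Metric_space_geodesic_dist:
  "Metric_space (sphere (0::'a::euclidean_space) 1) geodesic_dist"
proof
  fix x y :: 'a
  show "0 \<le> geodesic_dist x y"
  proof (cases "x \<in> sphere 0 1 \<and> y \<in> sphere 0 1")
    case True
    then show ?thesis
      by (blast intro: geodesic_dist_cos(1))
  next
    case False
    then show ?thesis
      by (simp only: geodesic_dist_def if_False order_refl)
  qed
  show "geodesic_dist x y = geodesic_dist y x"
    by (auto simp: geodesic_dist_def inner_commute)
next
  fix x y :: 'a
  assume xy: "x \<in> sphere 0 1" "y \<in> sphere 0 1"
  have "geodesic_dist x y = 0 \<longleftrightarrow> x \<bullet> y = 1"
    using geodesic_dist_cos(3)[OF xy] xy by (auto simp: geodesic_dist_def)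
  also have "\<dots> \<longleftrightarrow> (dist x y)\<^sup>2 = 0"
    using dist_sphere_power2[OF xy] by auto
  finally show "geodesic_dist x y = 0 \<longleftrightarrow> x = y"
    by simp
qed (rule geodesic_dist_triangle)

lemma mspace_geodesic_sphere [simp]: "mspace geodesic_sphere = sphere 0 1"
  unfolding geodesic_sphere_def by (rule Metric_space.mspace_metric[OF Metric_space_geodesic_dist])

lemma mdist_geodesic_sphere:
  assumes "x \<in> sphere 0 1" "y \<in> sphere 0 1"
  shows "mdist geodesic_sphere x y = arccos (x \<bullet> y)"
  using assms
  by (simp add: geodesic_sphere_def geodesic_dist_def
      Metric_space.mdist_metric[OF Metric_space_geodesic_dist])

lemma dist_le_geodesic_dist:
  fixes x y :: "'a::euclidean_space"
  assumes "x \<in> sphere 0 1" "y \<in> sphere 0 1"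
  shows "dist x y \<le> geodesic_dist x y"
proof -
  define a where "a = geodesic_dist x y"
  note a = geodesic_dist_cos[OF assms, folded a_def]
  have "cos a = 1 - 2 * (sin (a / 2))\<^sup>2"
    using cos_double_sin[of "a / 2"] by simp
  then have "(dist x y)\<^sup>2 = (2 * sin (a / 2))\<^sup>2"
    using dist_sphere_power2[OF assms] a(3) by (simp add: power_mult_distrib)
  moreover have "0 \<le> sin (a / 2)" "sin (a / 2) \<le> a / 2"
    using a(1,2) sin_x_le_x[of "a / 2"] by (auto intro!: sin_ge_zero)
  ultimately show ?thesis
    unfolding a_def[symmetric] using power2_eq_iff_nonneg[of "dist x y" "2 * sin (a / 2)"] by simp
qed

lemma mtopology_of_geodesic_sphere:
  "mtopology_of geodesic_sphere = top_of_set (sphere (0::'a::euclidean_space) 1)"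
proof -
  interpret Metric_space "sphere (0::'a) 1" geodesic_dist
    by (rule Metric_space_geodesic_dist)
  have 1: "mball x e \<subseteq> ball x e \<inter> sphere 0 1" for x :: 'a and e
    using dist_le_geodesic_dist by (force simp: mball_def)
  have 2: "\<exists>e>0. ball x e \<inter> sphere 0 1 \<subseteq> mball x r"
    if x: "x \<in> sphere 0 1" and r: "r > 0" for x :: 'a and r
  proof -
    define s where "s = min r pi"
    have s: "0 < s" "s \<le> pi" "s \<le> r"
      using r by (auto simp: s_def)
    have "cos s < 1"
      using cos_monotone_0_pi[of 0 s] s by simp
    moreover have "y \<in> mball x r" if y: "y \<in> ball x (sqrt (2 - 2 * cos s)) \<inter> sphere 0 1" for y
    proof -
      have y1: "y \<in> sphere 0 1" and "dist x y < sqrt (2 - 2 * cos s)"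
        using y by auto
      then have "(dist x y)\<^sup>2 < 2 - 2 * cos s"
        using real_sqrt_less_iff[of "(dist x y)\<^sup>2" "2 - 2 * cos s"] by simp
      then have "cos s < cos (geodesic_dist x y)"
        using dist_sphere_power2[OF x y1] geodesic_dist_cos(3)[OF x y1] by simp
      then have "geodesic_dist x y < s"
        using geodesic_dist_cos[OF x y1] s by (subst (asm) cos_mono_less_eq) auto
      then show ?thesis
        using x y1 s by (simp add: mball_def)
    qed
    ultimately show ?thesis
      by (intro exI[of _ "sqrt (2 - 2 * cos s)"]) auto
  qed
  have "openin mtopology U \<longleftrightarrow> openin (top_of_set (sphere 0 1)) U" for U :: "'a set"
  proof (cases "U \<subseteq> sphere 0 1")
    case True
    have "(\<exists>r>0. mball x r \<subseteq> U) \<longleftrightarrow> (\<exists>e>0. ball x e \<inter> sphere 0 1 \<subseteq> U)" if "x \<in> U" for x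
      using 1[of x] 2[of x] True that by (meson subset_trans subsetD)
    then show ?thesis
      unfolding openin_mtopology openin_contains_ball using True by blast
  next
    case False
    then show ?thesis
      unfolding openin_mtopology openin_contains_ball by blast
  qed
  then have "mtopology = top_of_set (sphere 0 1)"
    by (simp add: topology_eq)
  then show ?thesis
    by (simp add: geodesic_sphere_def)
qed

end

theory Submission
  imports Defs
begin

text \<open>
  Sending a point of the complex to its normalized barycenter gives a map \<open>f\<close> to the sphere, and a
  partition of unity on a fine finite net gives a map \<open>g\<close> back.  The composite \<open>f \<circ> g\<close> moves points
  by less than a right angle, so it is homotopic to the identity.  For \<open>g \<circ> f\<close>, a simplex \<open>\<sigma>\<close>
  is carried into a thin convex neighbourhood of its spherical convex hull.  The point \<open>q\<close> of the
  linear convex hull of \<open>\<sigma>\<close> nearest to the origin has norm at least \<open>1 / (n + 1)\<close>, which is where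
  the bound on \<open>r\<close> enters, and it makes an acute angle with every point of that neighbourhood.
  Hence the flow towards \<open>q\<close> does not increase distances there, whatever the scale \<open>r\<close>, and, cut into small steps,
  it contracts every finite subcomplex.  Homotopies into such contractible carriers
  extend from one skeleton to the next.
\<close>

section \<open>Maps into and out of geometric realizations\<close>

lemma simplex_topology_eq: "simplex_topology \<sigma> = top_of_set (closed_simplex \<sigma>)"
  by (simp add: simplex_topology_def euclidean_product_topology)

lemma closed_Collect_coordinate:
  fixes P :: "real \<Rightarrow> bool"
  assumes "closed {y. P y}"
  shows "closed {p::'v \<Rightarrow> real. P (p v)}"
proof -
  have "continuous_on UNIV (\<lambda>p::'v \<Rightarrow> real. p v)"
    by (rule continuous_on_product_coordinates)
  from closed_vimage[OF assms this] show ?thesis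
    by (simp only: vimage_Collect_eq)
qed

lemma closed_closed_simplex:
  assumes "finite \<sigma>"
  shows "closed (closed_simplex \<sigma>)"
proof -
  have "continuous_on UNIV (\<lambda>p::'a \<Rightarrow> real. \<Sum>v\<in>\<sigma>. p v)"
    by (intro continuous_on_sum continuous_on_product_coordinates)
  then have "closed {p::'a \<Rightarrow> real. (\<Sum>v\<in>\<sigma>. p v) = 1}"
    using closed_Collect_eq[OF _ continuous_on_const] by blast
  moreover have "closed {p::'a \<Rightarrow> real. \<forall>v. 0 \<le> p v}"
    by (intro closed_Collect_all closed_Collect_coordinate)
      (simp add: closed_real_atLeast[unfolded atLeast_def])
  moreover have "closed {p::'a \<Rightarrow> real. \<forall>v. v \<notin> \<sigma> \<longrightarrow> p v = 0}"
    by (intro closed_Collect_all closed_Collect_imp closed_Collect_coordinate) auto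
  moreover have "closed_simplex \<sigma> = {p. \<forall>v. 0 \<le> p v} \<inter> {p. \<forall>v. v \<notin> \<sigma> \<longrightarrow> p v = 0} \<inter> {p. (\<Sum>v\<in>\<sigma>. p v) = 1}"
    by (auto simp: closed_simplex_def)
  ultimately show ?thesis
    by (simp only: closed_Int)
qed

lemma closed_simplex_mono:
  assumes "finite \<tau>" "\<sigma> \<subseteq> \<tau>"
  shows "closed_simplex \<sigma> \<subseteq> closed_simplex \<tau>"
proof
  fix p assume p: "p \<in> closed_simplex \<sigma>"
  then have "sum p \<sigma> = sum p \<tau>"
    using assms by (intro sum.mono_neutral_left) (auto simp: closed_simplex_def)
  then show "p \<in> closed_simplex \<tau>"
    using p assms by (auto simp: closed_simplex_def)
qed

text \<open>A sum over an infinite set is 0 by convention and so cannot be 1.\<close>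

lemma finite_if_in_closed_simplex: "p \<in> closed_simplex \<sigma> \<Longrightarrow> finite \<sigma>"
  by (rule ccontr) (simp add: closed_simplex_def)

section \<open>Supports and realizations of full subcomplexes\<close>

definition support :: "('v \<Rightarrow> real) \<Rightarrow> 'v set" where
  "support p = {v. p v \<noteq> 0}"

lemma support_closed_simplex:
  assumes "p \<in> closed_simplex \<sigma>"
  shows "support p \<subseteq> \<sigma>" "support p \<noteq> {}" "finite (support p)"
proof -
  show "support p \<subseteq> \<sigma>"
    using assms by (auto simp: support_def closed_simplex_def)
  then show "finite (support p)"
    using finite_if_in_closed_simplex[OF assms] finite_subset by blast
  have "sum p \<sigma> \<noteq> 0"
    using assms by (simp add: closed_simplex_def)
  then show "support p \<noteq> {}"
    by (auto simp: support_def intro: sum.neutral)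
qed

lemma in_closed_simplex_iff_support:
  assumes "p \<in> closed_simplex \<tau>" "finite \<sigma>"
  shows "p \<in> closed_simplex \<sigma> \<longleftrightarrow> support p \<subseteq> \<sigma>"
proof
  assume *: "support p \<subseteq> \<sigma>"
  have "sum p (support p) = sum p \<tau>"
    using support_closed_simplex(1)[OF assms(1)] finite_if_in_closed_simplex[OF assms(1)]
    by (intro sum.mono_neutral_left) (auto simp: support_def)
  moreover have "sum p (support p) = sum p \<sigma>"
    using * assms(2) by (intro sum.mono_neutral_left) (auto simp: support_def)
  ultimately show "p \<in> closed_simplex \<sigma>"
    using assms * by (auto simp: closed_simplex_def support_def)
qed (use support_closed_simplex in blast)

text \<open>The realization of the full subcomplex on \<open>V\<close>. Membership is tested on the
  support, the unique simplex with the point in its interior, so no simplex has to be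
  chosen.\<close>

definition polyhedron_on :: "'v set set \<Rightarrow> 'v set \<Rightarrow> ('v \<Rightarrow> real) set" where
  "polyhedron_on K V = {p. support p \<in> K \<and> support p \<subseteq> V \<and> p \<in> closed_simplex (support p)}"

lemma polyhedron_on_mono: "V \<subseteq> W \<Longrightarrow> polyhedron_on K V \<subseteq> polyhedron_on K W"
  by (auto simp: polyhedron_on_def)

lemma simplex_of_complex:
  assumes "abstract_simplicial_complex K" "\<sigma> \<in> K"
  shows "finite \<sigma>" "\<sigma> \<noteq> {}" "\<And>\<tau>. \<tau> \<subseteq> \<sigma> \<Longrightarrow> \<tau> \<noteq> {} \<Longrightarrow> \<tau> \<in> K"
  using assms unfolding abstract_simplicial_complex_def by blast+

lemma closed_simplex_eq_polyhedron_on: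
  assumes K: "abstract_simplicial_complex K" and \<sigma>: "\<sigma> \<in> K"
  shows "closed_simplex \<sigma> = polyhedron_on K \<sigma>"
proof
  show "closed_simplex \<sigma> \<subseteq> polyhedron_on K \<sigma>"
  proof
    fix p assume p: "p \<in> closed_simplex \<sigma>"
    note s = support_closed_simplex[OF p]
    then show "p \<in> polyhedron_on K \<sigma>"
      using simplex_of_complex(3)[OF K \<sigma>] in_closed_simplex_iff_support[OF p s(3)]
      by (simp add: polyhedron_on_def)
  qed
  show "polyhedron_on K \<sigma> \<subseteq> closed_simplex \<sigma>"
    using simplex_of_complex(1)[OF K \<sigma>] in_closed_simplex_iff_support
    by (fastforce simp: polyhedron_on_def)
qed

lemma polyhedron_on_eq_Union:
  assumes K: "abstract_simplicial_complex K"
  shows "polyhedron_on K V = (\<Union>\<tau>\<in>{\<tau> \<in> K. \<tau> \<subseteq> V}. closed_simplex \<tau>)" (is "_ = ?R")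
proof
  show "polyhedron_on K V \<subseteq> ?R"
    by (auto simp: polyhedron_on_def)
  show "?R \<subseteq> polyhedron_on K V"
    using closed_simplex_eq_polyhedron_on[OF K] polyhedron_on_mono by blast
qed

lemma topspace_geometric_realization_polyhedron:
  "abstract_simplicial_complex K \<Longrightarrow> topspace (geometric_realization K) = polyhedron_on K UNIV"
  by (simp add: polyhedron_on_eq_Union)

text \<open>A weakly closed set meets every simplex in a closed set. Only finitely many simplices
  have their vertices in \<open>W\<close>, so the union of these traces is closed in the product
  topology as well.\<close>

lemma continuous_map_into_geometric_realization:
  fixes f :: "'b::topological_space \<Rightarrow> 'v \<Rightarrow> real"
  assumes K: "abstract_simplicial_complex K" and W: "finite W"
    and f: "continuous_on A f" "f ` A \<subseteq> polyhedron_on K W"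
  shows "continuous_map (top_of_set A) (geometric_realization K) f"
  unfolding continuous_map_closedin
proof (intro conjI allI impI ballI)
  show "f \<in> topspace (top_of_set A) \<rightarrow> topspace (geometric_realization K)"
    using f(2) polyhedron_on_mono[of W UNIV K]
    unfolding topspace_geometric_realization_polyhedron[OF K] by auto
  fix C assume C: "closedin (geometric_realization K) C"
  have "closed (C \<inter> closed_simplex \<tau>)" if "\<tau> \<in> K" for \<tau>
  proof -
    have "openin (geometric_realization K) (topspace (geometric_realization K) - C)"
      using C by blast
    then have "openin (simplex_topology \<tau>) ((topspace (geometric_realization K) - C) \<inter> closed_simplex \<tau>)"
      using that by (simp only: openin_geometric_realization)
    moreover have "(topspace (geometric_realization K) - C) \<inter> closed_simplex \<tau> = closed_simplex \<tau> - C \<inter> closed_simplex \<tau>"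
      using that by auto
    ultimately have "closedin (top_of_set (closed_simplex \<tau>)) (C \<inter> closed_simplex \<tau>)"
      by (simp add: closedin_def simplex_topology_eq)
    then show ?thesis
      using closed_closed_simplex closedin_closed_trans simplex_of_complex(1)[OF K that] by blast
  qed
  then have "closed (\<Union>\<tau>\<in>{\<tau> \<in> K. \<tau> \<subseteq> W}. C \<inter> closed_simplex \<tau>)"
    using W by (intro closed_UN) auto
  then have "closedin (top_of_set A) (A \<inter> f -` (\<Union>\<tau>\<in>{\<tau> \<in> K. \<tau> \<subseteq> W}. C \<inter> closed_simplex \<tau>))"
    using f(1) continuous_closedin_preimage by blast
  moreover have "A \<inter> f -` (\<Union>\<tau>\<in>{\<tau> \<in> K. \<tau> \<subseteq> W}. C \<inter> closed_simplex \<tau>) = {x \<in> A. f x \<in> C}"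
    using f(2) unfolding polyhedron_on_eq_Union[OF K] image_subset_iff by fastforce
  ultimately show "closedin (top_of_set A) {x \<in> topspace (top_of_set A). f x \<in> C}"
    by simp
qed

text \<open>The weak topology as a quotient of the disjoint union of the simplices; in this form it
  can be multiplied by the unit interval.\<close>

lemma quotient_map_sum_simplices:
  "quotient_map (sum_topology simplex_topology K) (geometric_realization K) snd"
  unfolding quotient_map_def
proof (intro conjI allI impI)
  show "snd ` topspace (sum_topology simplex_topology K) = topspace (geometric_realization K)"
    by force
  fix U assume U: "U \<subseteq> topspace (geometric_realization K)"
  have "{x. (\<sigma>, x) \<in> {x \<in> topspace (sum_topology simplex_topology K). snd x \<in> U}} = U \<inter> closed_simplex \<sigma>"
    if "\<sigma> \<in> K" for \<sigma>
    using that by auto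
  then show "openin (sum_topology simplex_topology K) {x \<in> topspace (sum_topology simplex_topology K). snd x \<in> U}
    \<longleftrightarrow> openin (geometric_realization K) U"
    using U unfolding openin_sum_topology openin_geometric_realization by auto
qed

lemma continuous_map_from_geometric_realization:
  "continuous_map (geometric_realization K) Y f
    \<longleftrightarrow> (\<forall>\<sigma>\<in>K. continuous_map (simplex_topology \<sigma>) Y f)" (is "?L \<longleftrightarrow> ?R")
proof
  assume ?L
  have "continuous_map (simplex_topology \<sigma>) (geometric_realization K) id" if "\<sigma> \<in> K" for \<sigma>
    using continuous_map_compose[OF continuous_map_component_injection[OF that]
        quotient_imp_continuous_map[OF quotient_map_sum_simplices]]
    by (simp add: o_def id_def)
  then show ?R
    using continuous_map_compose[OF _ \<open>?L\<close>, where f=id] by simp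
next
  assume R: ?R
  show ?L
    unfolding continuous_map_def
  proof (intro conjI allI impI)
    show "f \<in> topspace (geometric_realization K) \<rightarrow> topspace Y"
    proof
      fix p assume "p \<in> topspace (geometric_realization K)"
      then obtain \<sigma> where "\<sigma> \<in> K" "p \<in> topspace (simplex_topology \<sigma>)"
        by auto
      then show "f p \<in> topspace Y"
        using R unfolding continuous_map_def by blast
    qed
    fix U assume U: "openin Y U"
    have "{x \<in> topspace (geometric_realization K). f x \<in> U} \<inter> closed_simplex \<sigma>
        = {x \<in> topspace (simplex_topology \<sigma>). f x \<in> U}" if "\<sigma> \<in> K" for \<sigma>
      using that by auto
    moreover have "openin (simplex_topology \<sigma>) {x \<in> topspace (simplex_topology \<sigma>). f x \<in> U}" if "\<sigma> \<in> K" for \<sigma>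
      using R U that unfolding continuous_map_def by blast
    ultimately show "openin (geometric_realization K) {x \<in> topspace (geometric_realization K). f x \<in> U}"
      unfolding openin_geometric_realization by auto
  qed
qed

text \<open>Since the unit interval is locally compact, its product with a quotient map is a quotient map.\<close>

lemma continuous_map_from_interval_times_realization:
  assumes h: "\<And>\<sigma>. \<sigma> \<in> K \<Longrightarrow>
      continuous_map (prod_topology (top_of_set {0..1::real}) (simplex_topology \<sigma>)) Y h"
  shows "continuous_map (prod_topology (top_of_set {0..1::real}) (geometric_realization K)) Y h"
proof -
  let ?I = "top_of_set {0..1::real}" and ?S = "sum_topology simplex_topology K"
  define j where "j = (\<lambda>(t::real, x::'a set \<times> ('a \<Rightarrow> real)). (t, snd x))"
  have "quotient_map (prod_topology ?I ?S) (prod_topology ?I (geometric_realization K)) j"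
    unfolding j_def
    by (intro quotient_map_prod_right quotient_map_sum_simplices)
      (auto intro!: Hausdorff_space_subtopology compact_imp_locally_compact_space simp: compact_space_subtopology)
  moreover have "continuous_map (prod_topology ?I ?S) Y (h \<circ> j)"
    unfolding continuous_map_def
  proof (intro conjI allI impI)
    show "h \<circ> j \<in> topspace (prod_topology ?I ?S) \<rightarrow> topspace Y"
    proof
      fix x assume "x \<in> topspace (prod_topology ?I ?S)"
      then obtain \<sigma> where "\<sigma> \<in> K" "j x \<in> topspace (prod_topology ?I (simplex_topology \<sigma>))"
        by (auto simp: j_def)
      then show "(h \<circ> j) x \<in> topspace Y"
        using h[of \<sigma>] unfolding continuous_map_def by auto
    qed
    fix W assume W: "openin Y W"
    let ?P = "{x \<in> topspace (prod_topology ?I ?S). (h \<circ> j) x \<in> W}"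
    show "openin (prod_topology ?I ?S) ?P"
      unfolding openin_prod_topology_alt
    proof (intro allI impI)
      fix t :: real and y assume "(t, y) \<in> ?P"
      then obtain \<sigma> x where y: "y = (\<sigma>, x)" "\<sigma> \<in> K" and tx: "t \<in> {0..1}" "x \<in> closed_simplex \<sigma>" "h (t, x) \<in> W"
        by (cases y) (auto simp: j_def)
      have "openin (prod_topology ?I (simplex_topology \<sigma>))
          {z \<in> topspace (prod_topology ?I (simplex_topology \<sigma>)). h z \<in> W}"
        using h[OF y(2)] W unfolding continuous_map_def by blast
      moreover have "(t, x) \<in> {z \<in> topspace (prod_topology ?I (simplex_topology \<sigma>)). h z \<in> W}"
        using tx by simp
      ultimately have "\<exists>U V. openin ?I U \<and> openin (simplex_topology \<sigma>) V \<and> t \<in> U \<and> x \<in> V \<and>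
          U \<times> V \<subseteq> {z \<in> topspace (prod_topology ?I (simplex_topology \<sigma>)). h z \<in> W}"
        by (rule openin_prod_topology_alt[THEN iffD1, rule_format])
      then obtain U V where UV: "openin ?I U" "openin (simplex_topology \<sigma>) V" "t \<in> U" "x \<in> V"
        "U \<times> V \<subseteq> {z \<in> topspace (prod_topology ?I (simplex_topology \<sigma>)). h z \<in> W}"
        by (elim exE conjE)
      \<comment> \<open>Each summand is open in the disjoint union, so a box around the point in the
        prism over one simplex is already a box in the product with the whole union.\<close>
      have "openin ?S (Pair \<sigma> ` V)"
        using open_map_component_injection[OF y(2), of simplex_topology] UV(2) unfolding open_map_def by blast
      moreover have "U \<times> (Pair \<sigma> ` V) \<subseteq> ?P"
        using UV(5) y(2) by (auto simp: j_def)
      ultimately show "\<exists>U V. openin ?I U \<and> openin ?S V \<and> t \<in> U \<and> y \<in> V \<and> U \<times> V \<subseteq> ?P"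
        using UV y by blast
    qed
  qed
  ultimately show ?thesis
    using continuous_compose_quotient_map by blast
qed

section \<open>Null-homotopies from chains of contiguous vertex maps\<close>

text \<open>Push-forward of a probability weight along \<open>f\<close>. Only indices of nonzero
  weight have to land in \<open>\<rho>\<close>, so the target simplex may shrink with the point that
  is being mapped.\<close>

lemma closed_simplex_sum_vertices:
  assumes K: "abstract_simplicial_complex K" and \<rho>: "\<rho> \<in> K" and T: "finite T"
    and a: "\<And>x. x \<in> T \<Longrightarrow> 0 \<le> a x" "sum a T = 1" "\<And>x. x \<in> T \<Longrightarrow> a x \<noteq> 0 \<Longrightarrow> f x \<in> \<rho>"
  shows "(\<lambda>w. \<Sum>x\<in>T. a x * of_bool (f x = w)) \<in> closed_simplex \<rho>"
proof -
  have fin: "finite \<rho>"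
    using simplex_of_complex(1)[OF K \<rho>] .
  have "(\<Sum>w\<in>\<rho>. \<Sum>x\<in>T. a x * of_bool (f x = w)) = (\<Sum>x\<in>T. \<Sum>w\<in>\<rho>. a x * of_bool (f x = w))"
    by (rule sum.swap)
  also have "\<dots> = (\<Sum>x\<in>T. a x)"
  proof (rule sum.cong[OF refl])
    fix x assume x: "x \<in> T"
    show "(\<Sum>w\<in>\<rho>. a x * of_bool (f x = w)) = a x"
    proof (cases "a x = 0")
      case False
      then have "(\<Sum>w\<in>\<rho>. of_bool (f x = w)) = (1::real)"
        using a(3)[OF x] fin by (simp add: of_bool_def)
      then show ?thesis
        by (simp flip: sum_distrib_left)
    qed simp
  qed
  finally have "(\<Sum>w\<in>\<rho>. \<Sum>x\<in>T. a x * of_bool (f x = w)) = 1"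
    using a(2) by simp
  moreover have "(\<Sum>x\<in>T. a x * of_bool (f x = w)) = 0" if "w \<notin> \<rho>" for w
    using a(3) that by (intro sum.neutral) auto
  moreover have "0 \<le> (\<Sum>x\<in>T. a x * of_bool (f x = w))" for w
    using a(1) by (intro sum_nonneg) auto
  ultimately show ?thesis
    by (simp add: closed_simplex_def)
qed

text \<open>Consecutive vertex maps send each simplex into a common simplex, so their linear
  extensions can be interpolated there. A single formula for all times replaces the concatenation of
  \<open>N\<close> homotopies and makes continuity immediate; the final constant is the vertex
  \<open>q\<close>.\<close>

lemma contiguous_chain_nullhomotopic:
  fixes \<phi> :: "nat \<Rightarrow> 'v \<Rightarrow> 'v"
  assumes K: "abstract_simplicial_complex K" and V: "finite V" and N: "N > 0"
    and \<phi>0: "\<And>v. v \<in> V \<Longrightarrow> \<phi> 0 v = v" and \<phi>N: "\<And>v. v \<in> V \<Longrightarrow> \<phi> N v = q"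
    and contig: "\<And>\<tau> i. \<tau> \<in> K \<Longrightarrow> \<tau> \<subseteq> V \<Longrightarrow> i < N \<Longrightarrow> \<phi> i ` \<tau> \<union> \<phi> (Suc i) ` \<tau> \<in> K"
    and C: "\<And>i v. i \<le> N \<Longrightarrow> v \<in> V \<Longrightarrow> \<phi> i v \<in> C"
  shows "\<exists>F W c. finite W \<and> W \<subseteq> C \<and> continuous_on ({0..1::real} \<times> polyhedron_on K V) F \<and>
    F ` ({0..1} \<times> polyhedron_on K V) \<subseteq> polyhedron_on K W \<and>
    (\<forall>p\<in>polyhedron_on K V. F (0, p) = p \<and> F (1, p) = c)"
proof -
  \<comment> \<open>Tent functions peaking at \<open>i / N\<close>: on the unit interval they sum to
    1, and at most two consecutive ones are nonzero, so only contiguous maps are ever mixed.\<close>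
  define hat where "hat i s = max 0 (1 - \<bar>real N * s - real i\<bar>)" for i and s :: real
  define F :: "real \<times> ('v \<Rightarrow> real) \<Rightarrow> 'v \<Rightarrow> real" where
    "F = (\<lambda>(s, p) w. \<Sum>(v,i)\<in>V \<times> {..N}. p v * hat i s * of_bool (\<phi> i v = w))"
  define W where "W = (\<Union>i\<le>N. \<phi> i ` V)"
  have hat01: "hat i 0 = of_bool (i = 0)" "hat i 1 = of_bool (i = N)" if "i \<le> N" for i
    using that by (auto simp: hat_def)
  have sum_p: "sum p V = 1" if "p \<in> polyhedron_on K V" for p
  proof -
    have "p \<in> closed_simplex V"
      using that in_closed_simplex_iff_support[of p "support p" V] V by (simp add: polyhedron_on_def)
    then show ?thesis
      by (simp add: closed_simplex_def)
  qed
  have p0: "0 \<le> p v" if "p \<in> polyhedron_on K V" for p v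
    using that by (simp add: polyhedron_on_def closed_simplex_def)
  have mem: "F (s, p) \<in> polyhedron_on K W" if s: "s \<in> {0..1}" and p: "p \<in> polyhedron_on K V" for s p
  proof -
    \<comment> \<open>Left index of the active pair of tents. At \<open>s = 1\<close> the floor
      would be \<open>N\<close>, and the pair would run past the last map.\<close>
    define i0 where "i0 = (if s = 1 then N - 1 else nat \<lfloor>real N * s\<rfloor>)"
    have i0: "i0 < N" "real i0 \<le> real N * s" "real N * s \<le> real i0 + 1"
    proof -
      show "i0 < N"
      proof (cases "s = 1")
        case False
        then have "real N * s < real N" "0 \<le> real N * s"
          using s N by auto
        then show ?thesis
          using False by (simp add: i0_def nat_less_iff floor_less_iff)
      qed (use N in \<open>simp add: i0_def\<close>)
      show "real i0 \<le> real N * s" "real N * s \<le> real i0 + 1"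
        using s N by (auto simp: i0_def of_nat_diff)
    qed
    have hat_zero: "hat i s = 0" if "i \<noteq> i0" "i \<noteq> Suc i0" for i
      using that i0 by (auto simp: hat_def)
    have "(\<Sum>i\<le>N. hat i s) = (\<Sum>i\<in>{i0, Suc i0}. hat i s)"
      using i0(1) hat_zero by (intro sum.mono_neutral_right) auto
    also have "\<dots> = 1"
      using i0 by (simp add: hat_def)
    finally have hat_sum: "(\<Sum>i\<le>N. hat i s) = 1" .
    have \<tau>: "support p \<in> K" "support p \<subseteq> V"
      using p by (auto simp: polyhedron_on_def)
    let ?\<rho> = "\<phi> i0 ` support p \<union> \<phi> (Suc i0) ` support p"
    have \<rho>: "?\<rho> \<in> K"
      using contig \<tau> i0(1) by blast
    have "(\<lambda>w. \<Sum>x\<in>V \<times> {..N}. (p (fst x) * hat (snd x) s) * of_bool (\<phi> (snd x) (fst x) = w)) \<in> closed_simplex ?\<rho>"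
    proof (rule closed_simplex_sum_vertices[OF K \<rho>])
      show "(\<Sum>x\<in>V \<times> {..N}. p (fst x) * hat (snd x) s) = 1"
        using sum_p[OF p] hat_sum
        by (simp add: sum.cartesian_product[symmetric, of "\<lambda>v i. p v * hat i s", unfolded case_prod_unfold]
            flip: sum_distrib_left)
      show "\<phi> (snd x) (fst x) \<in> ?\<rho>" if "x \<in> V \<times> {..N}" "p (fst x) * hat (snd x) s \<noteq> 0" for x
      proof -
        have "snd x = i0 \<or> snd x = Suc i0" "fst x \<in> support p"
          using that hat_zero[of "snd x"] by (auto simp: support_def)
        then show ?thesis
          by auto
      qed
    qed (use V p0[OF p] in \<open>auto simp: hat_def\<close>)
    then have "F (s, p) \<in> closed_simplex ?\<rho>"
      by (simp add: F_def case_prod_unfold)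
    moreover have "?\<rho> \<subseteq> W"
      using \<tau> i0(1) by (fastforce simp: W_def)
    ultimately show ?thesis
      using closed_simplex_eq_polyhedron_on[OF K \<rho>] polyhedron_on_mono[of ?\<rho> W K] by auto
  qed
  have at0: "F (0, p) = p" if p: "p \<in> polyhedron_on K V" for p
  proof
    fix w
    have "F (0, p) w = (\<Sum>v\<in>V. \<Sum>i\<le>N. p v * hat i 0 * of_bool (\<phi> i v = w))"
      by (simp only: F_def prod.case sum.cartesian_product)
    also have "\<dots> = (\<Sum>v\<in>V. p v * of_bool (v = w))"
    proof (rule sum.cong[OF refl])
      fix v assume v: "v \<in> V"
      have "(\<Sum>i\<le>N. p v * hat i 0 * of_bool (\<phi> i v = w)) = (\<Sum>i\<in>{0}. p v * hat i 0 * of_bool (\<phi> i v = w))"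
        by (rule sum.mono_neutral_right) (auto simp: hat01)
      then show "(\<Sum>i\<le>N. p v * hat i 0 * of_bool (\<phi> i v = w)) = p v * of_bool (v = w)"
        using \<phi>0[OF v] by (simp add: hat01)
    qed
    also have "\<dots> = p w"
    proof (cases "w \<in> V")
      case True
      then show ?thesis
        using V by (simp add: of_bool_def if_distrib cong: if_cong)
    next
      case False
      then have "p w = 0"
        using p by (auto simp: polyhedron_on_def support_def)
      then show ?thesis
        using False by (auto intro!: sum.neutral)
    qed
    finally show "F (0, p) w = p w" .
  qed
  have at1: "F (1, p) = (\<lambda>w. of_bool (q = w))" if p: "p \<in> polyhedron_on K V" for p
  proof
    fix w
    have "F (1, p) w = (\<Sum>v\<in>V. \<Sum>i\<le>N. p v * hat i 1 * of_bool (\<phi> i v = w))"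
      by (simp only: F_def prod.case sum.cartesian_product)
    also have "\<dots> = (\<Sum>v\<in>V. p v * of_bool (q = w))"
    proof (rule sum.cong[OF refl])
      fix v assume v: "v \<in> V"
      have "(\<Sum>i\<le>N. p v * hat i 1 * of_bool (\<phi> i v = w)) = (\<Sum>i\<in>{N}. p v * hat i 1 * of_bool (\<phi> i v = w))"
        by (rule sum.mono_neutral_right) (auto simp: hat01)
      then show "(\<Sum>i\<le>N. p v * hat i 1 * of_bool (\<phi> i v = w)) = p v * of_bool (q = w)"
        using \<phi>N[OF v] by (simp add: hat01)
    qed
    also have "\<dots> = of_bool (q = w)"
      using sum_p[OF p] by (simp flip: sum_distrib_right)
    finally show "F (1, p) w = of_bool (q = w)" .
  qed
  have coord: "continuous_on A (\<lambda>x::real \<times> ('v \<Rightarrow> real). snd x v)" for A v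
    by (rule continuous_on_product_then_coordinatewise[where f = snd]) (intro continuous_intros)
  have "continuous_on A (\<lambda>x. F x w)" for w A
    unfolding F_def hat_def case_prod_unfold
    by (intro continuous_on_sum continuous_on_mult coord continuous_on_max continuous_on_diff
        continuous_on_rabs continuous_on_const continuous_on_fst continuous_on_id)
  then have "continuous_on ({0..1} \<times> polyhedron_on K V) F"
    by (rule continuous_on_coordinatewise_then_product)
  moreover have "finite W" "W \<subseteq> C"
    using V C by (auto simp: W_def)
  moreover have "F ` ({0..1} \<times> polyhedron_on K V) \<subseteq> polyhedron_on K W"
    using mem by auto
  ultimately show ?thesis
    by (intro exI[of _ F] exI[of _ W] exI[of _ "\<lambda>w. of_bool (q = w)"]) (simp add: at0 at1)
qed

section \<open>Homotopies carried by null-homotopic subcomplexes\<close>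

lemma continuous_on_Min:
  fixes f :: "'i \<Rightarrow> 'a::topological_space \<Rightarrow> real"
  assumes "finite I" "I \<noteq> {}" "\<And>i. i \<in> I \<Longrightarrow> continuous_on S (f i)"
  shows "continuous_on S (\<lambda>x. Min ((\<lambda>i. f i x) ` I))"
  using assms
proof (induction I rule: finite_ne_induct)
  case (insert i I)
  then have "continuous_on S (\<lambda>x. min (f i x) (Min ((\<lambda>i. f i x) ` I)))"
    by (intro continuous_on_min) auto
  then show ?case
    using insert by simp
qed simp

text \<open>The contraction may leave \<open>V\<close>, since a flow creates new vertices, but it
  stays over a finite \<open>W\<close> inside \<open>C\<close>. Finiteness on both sides lets all
  continuity be stated in the product topology.\<close>

definition finitely_nullhomotopic_in :: "'v set set \<Rightarrow> 'v set \<Rightarrow> bool" where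
  "finitely_nullhomotopic_in K C \<longleftrightarrow>
    (\<forall>V. finite V \<and> V \<subseteq> C \<longrightarrow> (\<exists>F W c. finite W \<and> W \<subseteq> C \<and>
      continuous_on ({0..1::real} \<times> polyhedron_on K V) F \<and>
      F ` ({0..1} \<times> polyhedron_on K V) \<subseteq> polyhedron_on K W \<and>
      (\<forall>p\<in>polyhedron_on K V. F (0, p) = p \<and> F (1, p) = c)))"

text \<open>
  The gauge \<open>m\<close> is 0 on the boundary of the prism over \<open>\<sigma>\<close> and 1 at its center; \<open>bd\<close> is the
  radial projection from the center.  The prescribed boundary values are contracted along
  \<open>F\<close> while \<open>m\<close> runs from 0 to 1/2.
\<close>

lemma extend_over_prism:
  fixes B :: "real \<times> ('v \<Rightarrow> real) \<Rightarrow> 'v \<Rightarrow> real"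
  assumes \<sigma>: "finite \<sigma>" "\<sigma> \<noteq> {}"
    and null: "finitely_nullhomotopic_in K C"
    and Bd: "Bd = {(t, p). t \<in> {0..1} \<and> p \<in> closed_simplex \<sigma> \<and> (t = 0 \<or> t = 1 \<or> (\<exists>v\<in>\<sigma>. p v = 0))}"
    and B: "continuous_on Bd B" "B ` Bd \<subseteq> polyhedron_on K V" and V: "finite V" "V \<subseteq> C"
  shows "\<exists>G W. continuous_on ({0..1} \<times> closed_simplex \<sigma>) G \<and> finite W \<and> W \<subseteq> C \<and>
    G ` ({0..1} \<times> closed_simplex \<sigma>) \<subseteq> polyhedron_on K W \<and> (\<forall>x\<in>Bd. G x = B x)"
proof -
  obtain F W c where W: "finite W" "W \<subseteq> C"
    and F: "continuous_on ({0..1::real} \<times> polyhedron_on K V) F"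
      "F ` ({0..1} \<times> polyhedron_on K V) \<subseteq> polyhedron_on K W"
      "\<And>p. p \<in> polyhedron_on K V \<Longrightarrow> F (0, p) = p" "\<And>p. p \<in> polyhedron_on K V \<Longrightarrow> F (1, p) = c"
    using null V unfolding finitely_nullhomotopic_in_def by meson
  let ?D = "{0..1} \<times> closed_simplex \<sigma>"
  define k where "k = real (card \<sigma>)"
  have k: "k > 0"
    using \<sigma> by (simp add: k_def card_gt_0_iff)
  \<comment> \<open>The factor \<open>k\<close> here and the factors 2 in \<open>m\<close> normalize
    the gauge: each term equals 1 at the center, which has time 1/2 and all coordinates
    \<open>1 / k\<close>.\<close>
  define m1 where "m1 x = Min ((\<lambda>v. k * snd x v) ` \<sigma>)" for x :: "real \<times> ('v \<Rightarrow> real)"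
  define m where "m x = min (min (2 * fst x) (2 * (1 - fst x))) (m1 x)" for x
  \<comment> \<open>Solution of x = (1 - m) * bd + m * center. The term attaining the minimum in
    \<open>m\<close> is what puts the result on the boundary. The factor \<open>of_bool\<close>
    keeps coordinates outside \<open>\<sigma>\<close> at 0, where the formula would give a negative
    value.\<close>
  define bd where "bd x = ((fst x - m x / 2) / (1 - m x),
    \<lambda>v. of_bool (v \<in> \<sigma>) * ((snd x v - m x / k) / (1 - m x)))" for x
  \<comment> \<open>The projection is singular at the center, where \<open>m\<close> is 1. Finishing
    the contraction at \<open>m = 1/2\<close> confines its use to the region where it is
    continuous.\<close>
  define G where "G x = (if m x \<le> 1/2 then F (2 * m x, B (bd x)) else c)" for x
  have coord: "continuous_on S (\<lambda>x::real \<times> ('v \<Rightarrow> real). snd x v)" for S v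
    by (rule continuous_on_product_then_coordinatewise[where f = snd]) (intro continuous_intros)
  have cont_m: "continuous_on S m" for S
    unfolding m_def m1_def using \<sigma> by (intro continuous_intros continuous_on_Min coord)
  have m_le: "m x \<le> 2 * fst x" "m x \<le> 2 * (1 - fst x)" for x
    by (auto simp: m_def)
  have m_le': "m x \<le> k * snd x v" if "v \<in> \<sigma>" for x v
  proof -
    have "m1 x \<le> k * snd x v"
      unfolding m1_def using \<sigma> that by (intro Min_le) auto
    then show ?thesis
      by (simp add: m_def)
  qed
  have m_eq: "m x = 2 * fst x \<or> m x = 2 * (1 - fst x) \<or> (\<exists>v\<in>\<sigma>. m x = k * snd x v)" for x
  proof -
    have "m1 x \<in> (\<lambda>v. k * snd x v) ` \<sigma>"
      unfolding m1_def using \<sigma> by (intro Min_in) auto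
    then show ?thesis
      by (auto simp: m_def min_def)
  qed
  have m0: "0 \<le> m x" if "x \<in> ?D" for x
    using m_eq[of x] that k by (auto simp: closed_simplex_def)
  have m_Bd: "m x = 0" if "x \<in> Bd" for x
  proof (rule antisym)
    show "m x \<le> 0"
      using that m_le[of x] m_le'[of _ x] by (fastforce simp: Bd)
    show "0 \<le> m x"
      using that by (intro m0) (auto simp: Bd)
  qed
  have bd_Bd: "bd x \<in> Bd" if x: "x \<in> ?D" "m x \<le> 1/2" for x
  proof -
    obtain t p where tp: "x = (t, p)" by (cases x)
    have p: "p \<in> closed_simplex \<sigma>" using x tp by simp
    have pos: "1 - m x > 0" using x by simp
    have "m x / k \<le> p v" if "v \<in> \<sigma>" for v
      using m_le'[OF that, of x] k tp by (simp add: field_simps)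
    then have nonneg: "0 \<le> (p v - m x / k) / (1 - m x)" if "v \<in> \<sigma>" for v
      using pos that by simp
    have "(\<Sum>v\<in>\<sigma>. of_bool (v \<in> \<sigma>) * ((p v - m x / k) / (1 - m x))) = (\<Sum>v\<in>\<sigma>. p v - m x / k) / (1 - m x)"
      by (simp add: sum_divide_distrib)
    also have "(\<Sum>v\<in>\<sigma>. p v - m x / k) = 1 - m x"
      using p k by (simp add: sum_subtractf closed_simplex_def k_def)
    finally have "(\<Sum>v\<in>\<sigma>. of_bool (v \<in> \<sigma>) * ((p v - m x / k) / (1 - m x))) = 1"
      using pos by simp
    then have "snd (bd x) \<in> closed_simplex \<sigma>"
      using nonneg tp by (auto simp: closed_simplex_def bd_def)
    moreover have "fst (bd x) \<in> {0..1}"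
      using m_le[of x] pos tp by (auto simp: bd_def field_simps)
    moreover have "fst (bd x) = 0 \<or> fst (bd x) = 1 \<or> (\<exists>v\<in>\<sigma>. snd (bd x) v = 0)"
      using m_eq[of x] pos k tp by (auto simp: bd_def field_simps)
    ultimately show ?thesis
      by (cases "bd x") (simp add: Bd)
  qed
  have bd_id: "bd x = x" if "x \<in> Bd" for x
    using that m_Bd[OF that] by (cases x) (auto simp: bd_def Bd closed_simplex_def of_bool_def fun_eq_iff)
  have "continuous_on ?D G"
    unfolding G_def
  proof (rule continuous_on_cases_le)
    have "continuous_on {x \<in> ?D. m x \<le> 1/2} (\<lambda>x. snd (bd x))"
      unfolding bd_def snd_conv
      by (rule continuous_on_coordinatewise_then_product) (use k in \<open>intro continuous_intros coord cont_m; auto\<close>)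
    moreover have "continuous_on {x \<in> ?D. m x \<le> 1/2} (\<lambda>x. fst (bd x))"
      unfolding bd_def fst_conv by (intro continuous_intros cont_m) auto
    ultimately have "continuous_on {x \<in> ?D. m x \<le> 1/2} bd"
      using continuous_on_Pair by fastforce
    then have "continuous_on {x \<in> ?D. m x \<le> 1/2} (\<lambda>x. B (bd x))"
      using bd_Bd by (intro continuous_on_compose2[OF B(1)]) auto
    then have "continuous_on {x \<in> ?D. m x \<le> 1/2} (\<lambda>x. (2 * m x, B (bd x)))"
      by (intro continuous_on_Pair continuous_on_mult continuous_on_const cont_m)
    then show "continuous_on {x \<in> ?D. m x \<le> 1/2} (\<lambda>x. F (2 * m x, B (bd x)))"
      by (rule continuous_on_compose2[OF F(1)]) (use bd_Bd B(2) m0 in auto)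
    show "F (2 * m x, B (bd x)) = c" if "x \<in> ?D" "m x = 1/2" for x
    proof -
      have "B (bd x) \<in> polyhedron_on K V"
        using B(2) bd_Bd[OF that(1)] that(2) by auto
      moreover have "2 * m x = 1"
        using that(2) by simp
      ultimately show ?thesis
        by (simp only: F(4))
    qed
  qed (auto intro: cont_m)
  moreover have "G x \<in> polyhedron_on K W" if x: "x \<in> ?D" for x
  proof (cases "m x \<le> 1/2")
    case True
    have "(2 * m x, B (bd x)) \<in> {0..1} \<times> polyhedron_on K V"
      using True x bd_Bd m0 B(2) by auto
    then show ?thesis
      using F(2) True by (auto simp: G_def)
  next
    case False
    \<comment> \<open>The point below \<open>x\<close> on the bottom face supplies an element of
      \<open>polyhedron_on K V\<close>, without which nothing would place \<open>c\<close> in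
      \<open>polyhedron_on K W\<close>.\<close>
    have "(0, snd x) \<in> Bd"
      using x by (auto simp: Bd)
    then have "B (0, snd x) \<in> polyhedron_on K V"
      using B(2) by blast
    then have "c \<in> polyhedron_on K W"
      using F(2,4) by fastforce
    then show ?thesis
      using False by (simp add: G_def)
  qed
  moreover have "G x = B x" if "x \<in> Bd" for x
    using m_Bd[OF that] bd_id[OF that] F(3) B(2) that by (auto simp: G_def)
  ultimately show ?thesis
    using W by (intro exI[of _ G] exI[of _ W]) (simp add: image_subset_iff)
qed


text \<open>\<open>H\<close> is one total function shared by all simplices, but only its values over
  \<open>\<sigma>\<close> matter, so it can be changed elsewhere. The finite set \<open>V\<close>
  may vary with \<open>\<sigma>\<close>.\<close>

definition carried_homotopy ::
    "'v set set \<Rightarrow> ('v set \<Rightarrow> 'v set) \<Rightarrow> (('v \<Rightarrow> real) \<Rightarrow> 'v \<Rightarrow> real) \<Rightarrow> 'v set \<Rightarrow> (real \<times> ('v \<Rightarrow> real) \<Rightarrow> 'v \<Rightarrow> real) \<Rightarrow> bool" where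
  "carried_homotopy K C b \<sigma> H \<longleftrightarrow>
    continuous_on ({0..1} \<times> closed_simplex \<sigma>) H \<and>
    (\<exists>V. finite V \<and> V \<subseteq> C \<sigma> \<and> H ` ({0..1} \<times> closed_simplex \<sigma>) \<subseteq> polyhedron_on K V) \<and>
    (\<forall>p\<in>closed_simplex \<sigma>. H (0, p) = p \<and> H (1, p) = b p)"

lemma carried_homotopy_cong:
  assumes "\<And>t p. t \<in> {0..1} \<Longrightarrow> p \<in> closed_simplex \<sigma> \<Longrightarrow> G (t, p) = H (t, p)"
  shows "carried_homotopy K C b \<sigma> G \<longleftrightarrow> carried_homotopy K C b \<sigma> H"
proof -
  have eq: "G x = H x" if "x \<in> {0..1} \<times> closed_simplex \<sigma>" for x
    using that assms by auto
  have "continuous_on ({0..1} \<times> closed_simplex \<sigma>) G \<longleftrightarrow> continuous_on ({0..1} \<times> closed_simplex \<sigma>) H"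
    using eq by (rule continuous_on_cong[OF refl])
  moreover have "G ` ({0..1} \<times> closed_simplex \<sigma>) = H ` ({0..1} \<times> closed_simplex \<sigma>)"
    using eq by (rule image_cong[OF refl])
  ultimately show ?thesis
    using assms[of 0] assms[of 1] unfolding carried_homotopy_def by auto
qed

lemma closed_simplex_facet:
  assumes "finite \<sigma>" "v \<in> \<sigma>"
  shows "closed_simplex (\<sigma> - {v}) = {p \<in> closed_simplex \<sigma>. p v = 0}"
  using assms by (auto simp: closed_simplex_def sum.remove)

text \<open>The boundary of the prism consists of bottom, top and the walls over the facets. The
  prescribed values agree on overlaps because \<open>H\<close> already joins the identity to
  \<open>b\<close> over proper faces, and \<open>mono\<close> puts their finite vertex sets into
  \<open>C \<sigma>\<close>. Agreement with \<open>H\<close> off the interior allows later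
  gluing.\<close>

lemma extend_carried_homotopy:
  assumes K: "abstract_simplicial_complex K" and \<sigma>: "\<sigma> \<in> K"
    and mono: "\<And>\<tau>. \<tau> \<in> K \<Longrightarrow> \<tau> \<subseteq> \<sigma> \<Longrightarrow> C \<tau> \<subseteq> C \<sigma>"
    and null: "finitely_nullhomotopic_in K (C \<sigma>)" and C: "\<sigma> \<subseteq> C \<sigma>"
    and b: "continuous_on (closed_simplex \<sigma>) b"
      "\<exists>V. finite V \<and> V \<subseteq> C \<sigma> \<and> b ` closed_simplex \<sigma> \<subseteq> polyhedron_on K V"
    and H: "\<And>\<tau>. \<tau> \<in> K \<Longrightarrow> \<tau> \<subset> \<sigma> \<Longrightarrow> carried_homotopy K C b \<tau> H"
  shows "\<exists>G. carried_homotopy K C b \<sigma> G \<and>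
    (\<forall>t\<in>{0..1}. \<forall>p\<in>closed_simplex \<sigma>. support p \<noteq> \<sigma> \<longrightarrow> G (t, p) = H (t, p))"
proof -
  note fin = simplex_of_complex(1,2)[OF K \<sigma>]
  define B where "B x = (if fst x = 0 then snd x else if fst x = 1 then b (snd x) else H x)" for x
  define Bd where
    "Bd = {(t::real, p). t \<in> {0..1} \<and> p \<in> closed_simplex \<sigma> \<and> (t = 0 \<or> t = 1 \<or> (\<exists>v\<in>\<sigma>. p v = 0))}"
  have Bd_eq: "Bd = {0} \<times> closed_simplex \<sigma> \<union> {1} \<times> closed_simplex \<sigma> \<union>
      (\<Union>v\<in>\<sigma>. {0..1} \<times> closed_simplex (\<sigma> - {v}))"
    by (auto simp: Bd_def closed_simplex_facet fin)
  have facet: "continuous_on ({0..1} \<times> closed_simplex (\<sigma> - {v})) B \<and>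
      (\<forall>x\<in>{0..1} \<times> closed_simplex (\<sigma> - {v}). B x = H x) \<and>
      (\<exists>V. finite V \<and> V \<subseteq> C \<sigma> \<and> B ` ({0..1} \<times> closed_simplex (\<sigma> - {v})) \<subseteq> polyhedron_on K V)"
    if v: "v \<in> \<sigma>" for v
  \<comment> \<open>A single vertex has an empty facet, which is not a simplex of \<open>K\<close>;
    the prism then has no walls.\<close>
  proof (cases "\<sigma> = {v}")
    case True
    then have "closed_simplex (\<sigma> - {v}) = {}"
      by (simp add: closed_simplex_def)
    then show ?thesis
      by (auto intro: exI[of _ "{}"])
  next
    case False
    then have \<tau>: "\<sigma> - {v} \<in> K" "\<sigma> - {v} \<subset> \<sigma>"
      using simplex_of_complex(3)[OF K \<sigma>, of "\<sigma> - {v}"] v by auto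
    have h: "carried_homotopy K C b (\<sigma> - {v}) H"
      using H[OF \<tau>] .
    have eq: "B x = H x" if "x \<in> {0..1} \<times> closed_simplex (\<sigma> - {v})" for x
      using h that by (cases x) (auto simp: B_def carried_homotopy_def)
    then have "carried_homotopy K C b (\<sigma> - {v}) B"
      using h carried_homotopy_cong[of "\<sigma> - {v}" B H] by auto
    then show ?thesis
      using eq mono[OF \<tau>(1)] unfolding carried_homotopy_def by blast
  qed
  have cont: "continuous_on Bd B"
    unfolding Bd_eq
  proof (intro continuous_on_closed_Un continuous_on_closed_Union closed_UN closed_Un closed_Times)
    have "continuous_on ({0} \<times> closed_simplex \<sigma>) snd"
      by (intro continuous_intros)
    then show "continuous_on ({0} \<times> closed_simplex \<sigma>) B"
      by (rule continuous_on_eq) (auto simp: B_def)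
    have "continuous_on ({1} \<times> closed_simplex \<sigma>) (\<lambda>x. b (snd x))"
      by (rule continuous_on_compose2[OF b(1)]) (auto intro: continuous_intros)
    then show "continuous_on ({1} \<times> closed_simplex \<sigma>) B"
      by (rule continuous_on_eq) (auto simp: B_def)
  qed (use fin facet in \<open>auto intro!: closed_Times closed_closed_simplex\<close>)
  obtain U where U: "\<And>v. v \<in> \<sigma> \<Longrightarrow> finite (U v) \<and> U v \<subseteq> C \<sigma> \<and>
      B ` ({0..1} \<times> closed_simplex (\<sigma> - {v})) \<subseteq> polyhedron_on K (U v)"
    using facet by metis
  obtain Vb where Vb: "finite Vb" "Vb \<subseteq> C \<sigma>" "b ` closed_simplex \<sigma> \<subseteq> polyhedron_on K Vb"
    using b(2) by blast
  define V where "V = \<sigma> \<union> Vb \<union> (\<Union>v\<in>\<sigma>. U v)"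
  have V: "finite V" "V \<subseteq> C \<sigma>"
    using fin Vb C U unfolding V_def by (simp, blast)
  have "B x \<in> polyhedron_on K V" if x: "x \<in> Bd" for x
  proof -
    consider "x \<in> {0} \<times> closed_simplex \<sigma>" | "x \<in> {1} \<times> closed_simplex \<sigma>"
      | v where "v \<in> \<sigma>" "x \<in> {0..1} \<times> closed_simplex (\<sigma> - {v})"
      using x unfolding Bd_eq by blast
    then show ?thesis
    proof cases
      case 1
      then have "B x \<in> closed_simplex \<sigma>"
        by (auto simp: B_def)
      then have "B x \<in> polyhedron_on K \<sigma>"
        by (simp only: closed_simplex_eq_polyhedron_on[OF K \<sigma>])
      then show ?thesis
        using polyhedron_on_mono[of \<sigma> V K] by (auto simp: V_def)
    next
      case 2
      then have "snd x \<in> closed_simplex \<sigma>" "B x = b (snd x)"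
        by (auto simp: B_def)
      then have "B x \<in> polyhedron_on K Vb"
        using Vb(3) by auto
      then show ?thesis
        using polyhedron_on_mono[of Vb V K] by (auto simp: V_def)
    next
      case 3
      then have "B x \<in> polyhedron_on K (U v)"
        using U by blast
      then show ?thesis
        using 3 polyhedron_on_mono[of "U v" V K] by (auto simp: V_def)
    qed
  qed
  then have "B ` Bd \<subseteq> polyhedron_on K V"
    by (simp add: image_subset_iff)
  from extend_over_prism[OF fin null Bd_def cont this V]
  obtain G W where "continuous_on ({0..1} \<times> closed_simplex \<sigma>) G \<and> finite W \<and> W \<subseteq> C \<sigma> \<and>
      G ` ({0..1} \<times> closed_simplex \<sigma>) \<subseteq> polyhedron_on K W \<and> (\<forall>x\<in>Bd. G x = B x)"
    by (elim exE)
  then have G: "continuous_on ({0..1} \<times> closed_simplex \<sigma>) G" "finite W" "W \<subseteq> C \<sigma>"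
      "G ` ({0..1} \<times> closed_simplex \<sigma>) \<subseteq> polyhedron_on K W" "\<And>x. x \<in> Bd \<Longrightarrow> G x = B x"
    by simp_all
  have "G (t, p) = H (t, p)" if t: "t \<in> {0..1}" and p: "p \<in> closed_simplex \<sigma>" "support p \<noteq> \<sigma>" for t p
  proof -
    obtain v where v: "v \<in> \<sigma>" "p v = 0"
      using p support_closed_simplex(1)[OF p(1)] by (auto simp: support_def)
    then have "p \<in> closed_simplex (\<sigma> - {v})" "(t, p) \<in> Bd"
      using p t by (auto simp: closed_simplex_facet fin Bd_def)
    then show ?thesis
      using G(5) facet[OF v(1)] t by auto
  qed
  moreover have "G (0, p) = p \<and> G (1, p) = b p" if "p \<in> closed_simplex \<sigma>" for p
    using that G(5) by (auto simp: Bd_def B_def)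
  ultimately show ?thesis
    using G(1-4) unfolding carried_homotopy_def
    by (intro exI[of _ G] conjI exI[of _ W] ballI impI) simp_all
qed


text \<open>Induction over skeleta. A stage alters only points whose support has the new
  cardinality, so the value at each point stabilizes and the stages have a limit. Continuity of the
  limit is checked over one simplex at a time, where it coincides with a single stage.\<close>

theorem carrier_homotopic_id:
  fixes K :: "'v set set"
  assumes K: "abstract_simplicial_complex K"
    and mono: "\<And>\<sigma> \<tau>. \<sigma> \<in> K \<Longrightarrow> \<tau> \<in> K \<Longrightarrow> \<tau> \<subseteq> \<sigma> \<Longrightarrow> C \<tau> \<subseteq> C \<sigma>"
    and null: "\<And>\<sigma>. \<sigma> \<in> K \<Longrightarrow> finitely_nullhomotopic_in K (C \<sigma>)"
    and C: "\<And>\<sigma>. \<sigma> \<in> K \<Longrightarrow> \<sigma> \<subseteq> C \<sigma>"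
    and b: "\<And>\<sigma>. \<sigma> \<in> K \<Longrightarrow> continuous_on (closed_simplex \<sigma>) b"
      "\<And>\<sigma>. \<sigma> \<in> K \<Longrightarrow> \<exists>V. finite V \<and> V \<subseteq> C \<sigma> \<and> b ` closed_simplex \<sigma> \<subseteq> polyhedron_on K V"
  shows "homotopic_with (\<lambda>_. True) (geometric_realization K) (geometric_realization K) id b"
proof -
  define P where "P k H \<longleftrightarrow> (\<forall>\<sigma>\<in>K. card \<sigma> \<le> k \<longrightarrow> carried_homotopy K C b \<sigma> H)" for k H
  define Q where "Q k H H' \<longleftrightarrow> (\<forall>t\<in>{0..1}. \<forall>p. card (support p) \<le> k \<longrightarrow> H' (t, p) = H (t, p))"
    for k :: nat and H H' :: "real \<times> ('v \<Rightarrow> real) \<Rightarrow> 'v \<Rightarrow> real"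
  have "P 0 (\<lambda>_. undefined)"
    using simplex_of_complex(1,2)[OF K] by (simp add: P_def)
  moreover have "\<exists>H'. P (Suc k) H' \<and> Q k H H'" if H: "P k H" for k H
  proof -
    have "\<exists>G. carried_homotopy K C b \<sigma> G \<and>
        (\<forall>t\<in>{0..1}. \<forall>p\<in>closed_simplex \<sigma>. support p \<noteq> \<sigma> \<longrightarrow> G (t, p) = H (t, p))"
      if \<sigma>: "\<sigma> \<in> K" "card \<sigma> = Suc k" for \<sigma>
    proof (rule extend_carried_homotopy[where C = C and b = b, OF K \<sigma>(1) mono[OF \<sigma>(1)] null[OF \<sigma>(1)] C[OF \<sigma>(1)]
          b(1)[OF \<sigma>(1)] b(2)[OF \<sigma>(1)]])
      show "carried_homotopy K C b \<tau> H" if "\<tau> \<in> K" "\<tau> \<subset> \<sigma>" for \<tau>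
        using psubset_card_mono[OF simplex_of_complex(1)[OF K \<sigma>(1)] that(2)] \<sigma>(2) H that(1)
        by (simp add: P_def)
    qed
    then have "\<forall>\<sigma>\<in>{\<sigma> \<in> K. card \<sigma> = Suc k}. \<exists>G. carried_homotopy K C b \<sigma> G \<and>
        (\<forall>t\<in>{0..1}. \<forall>p\<in>closed_simplex \<sigma>. support p \<noteq> \<sigma> \<longrightarrow> G (t, p) = H (t, p))"
      by simp
    from bchoice[OF this] obtain G where "\<forall>\<sigma>\<in>{\<sigma> \<in> K. card \<sigma> = Suc k}. carried_homotopy K C b \<sigma> (G \<sigma>) \<and>
        (\<forall>t\<in>{0..1}. \<forall>p\<in>closed_simplex \<sigma>. support p \<noteq> \<sigma> \<longrightarrow> G \<sigma> (t, p) = H (t, p))"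
      by (elim exE)
    then have G: "\<And>\<sigma>. \<sigma> \<in> K \<Longrightarrow> card \<sigma> = Suc k \<Longrightarrow> carried_homotopy K C b \<sigma> (G \<sigma>)"
        "\<And>\<sigma> t p. \<sigma> \<in> K \<Longrightarrow> card \<sigma> = Suc k \<Longrightarrow> t \<in> {0..1} \<Longrightarrow> p \<in> closed_simplex \<sigma> \<Longrightarrow>
          support p \<noteq> \<sigma> \<Longrightarrow> G \<sigma> (t, p) = H (t, p)"
      by simp_all
    \<comment> \<open>Each point is interior to exactly one simplex, its support, so the separately
      chosen extensions never compete for a point.\<close>
    define H' where "H' x = (if card (support (snd x)) = Suc k then G (support (snd x)) x else H x)" for x
    have "carried_homotopy K C b \<sigma> H'" if \<sigma>: "\<sigma> \<in> K" "card \<sigma> \<le> Suc k" for \<sigma>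
    proof (cases "card \<sigma> = Suc k")
      case True
      have "H' (t, p) = G \<sigma> (t, p)" if tp: "t \<in> {0..1}" "p \<in> closed_simplex \<sigma>" for t p
      proof (cases "support p = \<sigma>")
        case True
        then show ?thesis
          using \<open>card \<sigma> = Suc k\<close> by (simp add: H'_def)
      next
        case False
        then have "card (support p) < Suc k"
          using psubset_card_mono[OF simplex_of_complex(1)[OF K \<sigma>(1)], of "support p"]
            support_closed_simplex(1)[OF tp(2)] True by auto
        then show ?thesis
          using G(2)[OF \<sigma>(1) True tp False] by (simp add: H'_def)
      qed
      then show ?thesis
        using G(1)[OF \<sigma>(1) True] carried_homotopy_cong[of \<sigma> H' "G \<sigma>"] by blast
    next
      case False
      have "H' (t, p) = H (t, p)" if tp: "p \<in> closed_simplex \<sigma>" for t p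
        using card_mono[OF simplex_of_complex(1)[OF K \<sigma>(1)] support_closed_simplex(1)[OF tp]] False \<sigma>(2)
        by (simp add: H'_def)
      then show ?thesis
        using H False \<sigma> carried_homotopy_cong[of \<sigma> H' H] by (simp add: P_def)
    qed
    then show ?thesis
      by (intro exI[of _ H']) (auto simp: P_def Q_def H'_def)
  qed
  ultimately obtain h where h: "\<And>k. P k (h k)" "\<And>k. Q k (h k) (h (Suc k))"
    using dependent_nat_choice[of P Q] by blast
  \<comment> \<open>The first stage that fixes the value at \<open>x\<close> is given by the size of
    its support.\<close>
  define H where "H x = h (card (support (snd x))) x" for x
  have stable: "h (k + j) (t, p) = h k (t, p)" if "t \<in> {0..1}" "card (support p) \<le> k" for k j t p
    using that h(2) by (induction j) (auto simp: Q_def)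
  have carried: "carried_homotopy K C b \<sigma> H" if \<sigma>: "\<sigma> \<in> K" for \<sigma>
  proof -
    have "H (t, p) = h (card \<sigma>) (t, p)" if "t \<in> {0..1}" "p \<in> closed_simplex \<sigma>" for t p
      using stable[OF that(1) order_refl, of p "card \<sigma> - card (support p)"]
        card_mono[OF simplex_of_complex(1)[OF K \<sigma>] support_closed_simplex(1)[OF that(2)]]
      by (simp add: H_def)
    then show ?thesis
      using carried_homotopy_cong[of \<sigma> H "h (card \<sigma>)"] h(1)[of "card \<sigma>"] \<sigma> by (simp add: P_def)
  qed
  have "continuous_map (prod_topology (top_of_set {0..1}) (geometric_realization K)) (geometric_realization K) H"
  proof (rule continuous_map_from_interval_times_realization)
    fix \<sigma> assume \<sigma>: "\<sigma> \<in> K"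
    then obtain V where "finite V" "H ` ({0..1} \<times> closed_simplex \<sigma>) \<subseteq> polyhedron_on K V"
        "continuous_on ({0..1} \<times> closed_simplex \<sigma>) H"
      using carried unfolding carried_homotopy_def by blast
    then show "continuous_map (prod_topology (top_of_set {0..1}) (simplex_topology \<sigma>)) (geometric_realization K) H"
      using continuous_map_into_geometric_realization[OF K] by (simp add: simplex_topology_eq)
  qed
  moreover have "H (0, p) = p \<and> H (1, p) = b p" if "p \<in> topspace (geometric_realization K)" for p
    using that carried unfolding carried_homotopy_def by auto
  ultimately show ?thesis
    unfolding homotopic_with[of _ "\<lambda>_. True", simplified] by auto
qed

section \<open>Spherical convexity\<close>

text \<open>Expand the square: diagonal inner products are 1, all others at least \<open>c\<close>,
  which gives c + (1 - c) times the sum of the squared weights. By Cauchy-Schwarz that sum is at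
  least \<open>1 / card S\<close>. The barycenter of a regular simplex attains equality.\<close>

lemma norm_sq_convex_combination_ge:
  fixes u :: "'a::real_inner \<Rightarrow> real"
  assumes S: "finite S" "\<And>x. x \<in> S \<Longrightarrow> norm x = 1"
    and c: "\<And>x y. x \<in> S \<Longrightarrow> y \<in> S \<Longrightarrow> c \<le> x \<bullet> y" "c \<le> 1"
    and u: "\<And>x. x \<in> S \<Longrightarrow> 0 \<le> u x" "sum u S = 1"
  shows "c + (1 - c) / card S \<le> (norm (\<Sum>x\<in>S. u x *\<^sub>R x))\<^sup>2"
proof -
  have cardpos: "card S > 0"
    using S(1) u(2) by (auto simp: card_gt_0_iff)
  have "1 \<le> (\<Sum>x\<in>S. (u x)\<^sup>2) * card S"
    using sum_squared_le_sum_of_squares[of u S] u(2) by simp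
  then have sq: "1 / card S \<le> (\<Sum>x\<in>S. (u x)\<^sup>2)"
    using cardpos by (simp add: field_simps)
  have "c + (1 - c) / card S \<le> c + (1 - c) * (\<Sum>x\<in>S. (u x)\<^sup>2)"
    using mult_left_mono[OF sq, of "1 - c"] c(2) by simp
  also have "\<dots> = (\<Sum>x\<in>S. \<Sum>y\<in>S. u x * u y * (c + (1 - c) * of_bool (x = y)))"
  proof -
    have "(\<Sum>y\<in>S. u x * u y * (c + (1 - c) * of_bool (x = y))) = c * u x + (1 - c) * (u x)\<^sup>2" if x: "x \<in> S" for x
    proof -
      have "(\<Sum>y\<in>S. u x * u y * (c + (1 - c) * of_bool (x = y)))
          = (\<Sum>y\<in>S. c * u x * u y + (if x = y then (1 - c) * (u x)\<^sup>2 else 0))"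
        by (rule sum.cong[OF refl]) (auto simp: algebra_simps power2_eq_square)
      also have "\<dots> = c * u x * sum u S + (1 - c) * (u x)\<^sup>2"
        using x S(1) by (simp add: sum.distrib sum_distrib_left)
      finally show ?thesis
        using u(2) by simp
    qed
    then show ?thesis
      using u(2) by (simp add: sum.distrib flip: sum_distrib_left)
  qed
  also have "\<dots> \<le> (\<Sum>x\<in>S. \<Sum>y\<in>S. u x * u y * (x \<bullet> y))"
  proof (intro sum_mono mult_left_mono)
    show "c + (1 - c) * of_bool (x = y) \<le> x \<bullet> y" if "x \<in> S" "y \<in> S" for x y
      using c(1)[OF that] S(2)[OF that(1)] by (cases "x = y") (simp_all add: dot_square_norm)
    show "0 \<le> u x * u y" if "x \<in> S" "y \<in> S" for x y
      using u(1) that by simp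
  qed
  also have "\<dots> = (norm (\<Sum>x\<in>S. u x *\<^sub>R x))\<^sup>2"
    unfolding power2_norm_eq_inner inner_sum_left unfolding inner_sum_right by (simp add: mult.assoc mult.left_commute)
  finally show ?thesis .
qed

text \<open>
  The nearest point to the origin lies on a proper face, so Caratheodory's theorem represents
  it by \<open>DIM('a)\<close> vertices; this makes the bound uniform although the origin itself
  can come arbitrarily close to being a combination of \<open>DIM('a) + 1\<close> vertices.
\<close>

lemma convex_hull_separated_from_0:
  fixes \<sigma> :: "'a::euclidean_space set"
  assumes \<sigma>: "finite \<sigma>" "\<sigma> \<noteq> {}" "\<sigma> \<subseteq> sphere 0 1"
    and far: "\<And>x y. x \<in> \<sigma> \<Longrightarrow> y \<in> \<sigma> \<Longrightarrow> - 1 / DIM('a) < x \<bullet> y"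
  obtains q where "q \<in> convex hull \<sigma>" "1 / DIM('a) \<le> norm q"
    "\<And>z. z \<in> convex hull \<sigma> \<Longrightarrow> (norm q)\<^sup>2 \<le> z \<bullet> q"
proof -
  define d where "d = real (DIM('a))"
  have d: "d > 0"
    by (simp add: d_def)
  have unit: "norm x = 1" if "x \<in> \<sigma>" for x
    using \<sigma>(3) that by auto
  have nz: "0 \<notin> convex hull \<sigma>"
  proof
    assume "0 \<in> convex hull \<sigma>"
    then obtain S u where S: "finite S" "S \<subseteq> \<sigma>" "card S \<le> DIM('a) + 1"
      and u: "\<forall>x\<in>S. 0 \<le> u x" "sum u S = 1" "(\<Sum>v\<in>S. u v *\<^sub>R v) = 0"
      unfolding convex_hull_caratheodory by blast
    \<comment> \<open>The minimum over the finite set stays strictly above -1/d. The value -1/d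
      itself would only give a bound of 0 for \<open>d + 1\<close> vertices and no
      contradiction.\<close>
    define c where "c = Min ((\<lambda>(x, y). x \<bullet> y) ` (S \<times> S))"
    have ne: "S \<noteq> {}"
      using u(2) by auto
    have c_in: "c \<in> (\<lambda>(x, y). x \<bullet> y) ` (S \<times> S)"
      unfolding c_def using S(1) ne by (intro Min_in) auto
    have c_le: "c \<le> x \<bullet> y" if "x \<in> S" "y \<in> S" for x y
      unfolding c_def using S(1) that by (intro Min_le) auto
    have c: "- 1 / d < c"
      using c_in far S(2) by (auto simp: d_def)
    obtain x where x: "x \<in> S"
      using ne by blast
    have c1: "c \<le> 1"
      using c_le[OF x x] unit[of x] x S(2) by (auto simp: dot_square_norm)
    have k: "0 < card S"
      using S(1) ne by (simp add: card_gt_0_iff)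
    have "c + (1 - c) / card S \<le> 0"
      using norm_sq_convex_combination_ge[of S c u] S unit c_le c1 u by auto
    then have "c * (real (card S) - 1) + 1 \<le> 0"
      using k by (simp add: field_simps)
    moreover have "c * (real (card S) - 1) > - 1"
    proof (cases "c \<ge> 0")
      case True
      then have "c * (real (card S) - 1) \<ge> 0"
        using k by simp
      then show ?thesis by simp
    next
      case False
      have "c * (real (card S) - 1) \<ge> c * d"
        using False S(3) by (intro mult_left_mono_neg) (auto simp: d_def)
      moreover have "c * d > - 1"
        using c d by (simp add: field_simps)
      ultimately show ?thesis by simp
    qed
    ultimately show False by simp
  qed
  define q where "q = closest_point (convex hull \<sigma>) 0"
  have cl: "closed (convex hull \<sigma>)" "convex hull \<sigma> \<noteq> {}"
    using \<sigma> by (auto intro: compact_imp_closed finite_imp_compact_convex_hull)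
  have q: "q \<in> convex hull \<sigma>"
    unfolding q_def using cl by (rule closest_point_in_set)
  have q0: "q \<noteq> 0"
    using q nz by auto
  have dot: "(norm q)\<^sup>2 \<le> z \<bullet> q" if "z \<in> convex hull \<sigma>" for z
    using closest_point_dot[OF convex_convex_hull cl(1) that, of 0]
    by (simp add: q_def[symmetric] power2_norm_eq_inner inner_diff_right inner_commute)
  obtain S u where S: "finite S" "S \<subseteq> \<sigma>"
    and u: "\<forall>x\<in>S. 0 \<le> u x" "sum u S = 1" "(\<Sum>v\<in>S. u v *\<^sub>R v) = q"
    using q unfolding convex_hull_explicit by blast
  define S' where "S' = {v \<in> S. u v \<noteq> 0}"
  have S': "finite S'" "S' \<subseteq> \<sigma>"
    using S by (auto simp: S'_def)
  have "sum u S' = 1" "(\<Sum>v\<in>S'. u v *\<^sub>R v) = q"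
    unfolding u(2,3)[symmetric] S'_def using S(1) by (auto intro!: sum.mono_neutral_left)
  then have q_S': "q \<in> convex hull S'"
    unfolding convex_hull_explicit using S' u(1) by (fastforce simp: S'_def)
  have "v \<bullet> q = (norm q)\<^sup>2" if v: "v \<in> S'" for v
  proof -
    \<comment> \<open>A weighted average of nonnegative terms that vanishes: every vertex of nonzero
      weight lies on the hyperplane supporting the hull at \<open>q\<close>.\<close>
    have "(\<Sum>v\<in>S. u v * (v \<bullet> q - (norm q)\<^sup>2)) = (\<Sum>v\<in>S. u v *\<^sub>R v) \<bullet> q - sum u S * (norm q)\<^sup>2"
      by (simp add: inner_sum_left sum_subtractf right_diff_distrib sum_distrib_right)
    also have "\<dots> = 0"
      using u by (simp add: power2_norm_eq_inner)
    finally have "\<forall>v\<in>S. u v * (v \<bullet> q - (norm q)\<^sup>2) = 0"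
      using S u(1) dot hull_inc[of _ \<sigma> convex]
      by (subst (asm) sum_nonneg_eq_0_iff) auto
    then show ?thesis
      using v by (auto simp: S'_def)
  qed
  then have "aff_dim S' \<le> aff_dim {x. q \<bullet> x = (norm q)\<^sup>2}"
    by (intro aff_dim_subset) (auto simp: inner_commute)
  then have aff: "aff_dim S' \<le> int (DIM('a)) - 1"
    using q0 by simp
  obtain T w where T: "finite T" "T \<subseteq> S'" "int (card T) \<le> aff_dim S' + 1"
    and w: "\<forall>x\<in>T. 0 \<le> w x" "sum w T = 1" "(\<Sum>v\<in>T. w v *\<^sub>R v) = q"
    using q_S' unfolding convex_hull_caratheodory_aff_dim by blast
  have k: "0 < card T" "real (card T) \<le> d"
    using T aff w(2) by (auto simp: card_gt_0_iff d_def)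
  \<comment> \<open>For \<open>d\<close> vertices the left side is exactly
    \<open>(1 / d)\<^sup>2\<close>, and fewer vertices only enlarge it; this is the origin of the
    constant \<open>1 / DIM('a)\<close>.\<close>
  have "- 1 / d + (1 + 1 / d) / card T \<le> (norm q)\<^sup>2"
  proof -
    have "T \<subseteq> \<sigma>"
      using T(2) S'(2) by blast
    then have "- 1 / d \<le> x \<bullet> y" if "x \<in> T" "y \<in> T" for x y
      using far[of x y, THEN less_imp_le] that by (simp add: d_def subset_iff)
    moreover have "- 1 / d \<le> 1"
      using d by (simp add: field_simps)
    ultimately show ?thesis
      using norm_sq_convex_combination_ge[of T "- 1 / d" w] T(1) \<open>T \<subseteq> \<sigma>\<close> unit w by auto
  qed
  moreover have "- 1 / d + (1 + 1 / d) / d \<le> - 1 / d + (1 + 1 / d) / card T"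
    using k d by (intro add_left_mono divide_left_mono) auto
  moreover have "- 1 / d + (1 + 1 / d) / d = (1 / d)\<^sup>2"
    using d by (simp add: field_simps power2_eq_square)
  ultimately have "(1 / d)\<^sup>2 \<le> (norm q)\<^sup>2"
    by simp
  then have "1 / d \<le> norm q"
    by (rule power2_le_imp_le) simp
  then show ?thesis
    using that[OF q _ dot] by (simp add: d_def)
qed

text \<open>Write R = t(1-t)(x.q + y.q) + t^2, so that u.v = (1-t)^2 (x.y) + R. If x.y is
  nonnegative, the AM-GM inequality bounds |u||v| by (1-t)^2 + R, and x.y is at most 1. If x.y is
  negative, it suffices that |u| and |v| are at least 1-t, because R is nonnegative.\<close>

lemma inner_sgn_flow_ge:
  fixes x y q :: "'a::real_inner"
  assumes unit: "norm x = 1" "norm y = 1" "norm q = 1"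
    and pos: "0 < x \<bullet> q" "0 < y \<bullet> q" and t: "t \<in> {0..1}"
  shows "x \<bullet> y \<le> sgn ((1 - t) *\<^sub>R x + t *\<^sub>R q) \<bullet> sgn ((1 - t) *\<^sub>R y + t *\<^sub>R q)"
proof -
  define u v where "u = (1 - t) *\<^sub>R x + t *\<^sub>R q" and "v = (1 - t) *\<^sub>R y + t *\<^sub>R q"
  have sq: "x \<bullet> x = 1" "y \<bullet> y = 1" "q \<bullet> q = 1"
    using unit by (simp_all add: dot_square_norm)
  have uu: "(norm u)\<^sup>2 = (1 - t)\<^sup>2 + 2 * t * (1 - t) * (x \<bullet> q) + t\<^sup>2"
    unfolding power2_norm_eq_inner u_def
    by (simp add: inner_add_left inner_add_right sq inner_commute power2_eq_square algebra_simps)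
  have vv: "(norm v)\<^sup>2 = (1 - t)\<^sup>2 + 2 * t * (1 - t) * (y \<bullet> q) + t\<^sup>2"
    unfolding power2_norm_eq_inner v_def
    by (simp add: inner_add_left inner_add_right sq inner_commute power2_eq_square algebra_simps)
  have uv: "u \<bullet> v = (1 - t)\<^sup>2 * (x \<bullet> y) + t * (1 - t) * (x \<bullet> q + y \<bullet> q) + t\<^sup>2"
    unfolding u_def v_def
    by (simp add: inner_add_left inner_add_right sq inner_commute power2_eq_square algebra_simps)
  have xy: "x \<bullet> y \<le> 1"
    using Cauchy_Schwarz_ineq2[of x y] unit by simp
  have upos: "u \<bullet> q > 0"
  proof -
    have "u \<bullet> q = (1 - t) * (x \<bullet> q) + t"
      by (simp add: u_def inner_add_left sq)
    then show ?thesis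
      using t pos(1) by (cases "t = 1") (auto intro: add_pos_nonneg)
  qed
  have vpos: "v \<bullet> q > 0"
  proof -
    have "v \<bullet> q = (1 - t) * (y \<bullet> q) + t"
      by (simp add: v_def inner_add_left sq)
    then show ?thesis
      using t pos(2) by (cases "t = 1") (auto intro: add_pos_nonneg)
  qed
  have n: "norm u > 0" "norm v > 0"
    using upos vpos by auto
  have cross: "0 \<le> t * (1 - t) * (x \<bullet> q)" "0 \<le> t * (1 - t) * (y \<bullet> q)"
    using t pos by auto
  have "(x \<bullet> y) * (norm u * norm v) \<le> u \<bullet> v"
  proof (cases "x \<bullet> y \<ge> 0")
    case True
    have "2 * (norm u * norm v) \<le> (norm u)\<^sup>2 + (norm v)\<^sup>2"
      using sum_squares_bound[of "norm u" "norm v"] by simp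
    then have "norm u * norm v \<le> (1 - t)\<^sup>2 + (t * (1 - t) * (x \<bullet> q + y \<bullet> q) + t\<^sup>2)"
      unfolding uu vv by (simp add: algebra_simps)
    then have "(x \<bullet> y) * (norm u * norm v) \<le> (x \<bullet> y) * ((1 - t)\<^sup>2 + (t * (1 - t) * (x \<bullet> q + y \<bullet> q) + t\<^sup>2))"
      using True by (rule mult_left_mono)
    moreover have "(x \<bullet> y) * (t * (1 - t) * (x \<bullet> q + y \<bullet> q) + t\<^sup>2) \<le> 1 * (t * (1 - t) * (x \<bullet> q + y \<bullet> q) + t\<^sup>2)"
      using xy cross by (intro mult_right_mono) (auto simp: distrib_left)
    ultimately show ?thesis
      unfolding uv by (simp add: algebra_simps)
  next
    case False
    have "(1 - t)\<^sup>2 \<le> (norm u)\<^sup>2" "(1 - t)\<^sup>2 \<le> (norm v)\<^sup>2"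
      unfolding uu vv using cross by auto
    then have "1 - t \<le> norm u" "1 - t \<le> norm v"
      by (auto intro: power2_le_imp_le)
    then have "(1 - t)\<^sup>2 \<le> norm u * norm v"
      unfolding power2_eq_square using t by (intro mult_mono) auto
    then have "(x \<bullet> y) * (norm u * norm v) \<le> (x \<bullet> y) * (1 - t)\<^sup>2"
      using False by (intro mult_left_mono_neg) auto
    also have "\<dots> \<le> u \<bullet> v"
      unfolding uv using cross by (simp add: distrib_left mult.commute)
    finally show ?thesis .
  qed
  then have "x \<bullet> y \<le> (u \<bullet> v) / (norm u * norm v)"
    using n by (simp add: le_divide_eq)
  also have "\<dots> = sgn u \<bullet> sgn v"
    by (simp add: sgn_div_norm divide_inverse)
  finally show ?thesis
    unfolding u_def v_def .
qed

text \<open>The width is measured in the linear space: the ray through \<open>y\<close> has to pass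
  within \<open>\<epsilon>\<close> of the convex hull. These rays fill the cone over a convex set,
  so convexity needs no geodesics.\<close>

definition spherical_hull_nbhd :: "real \<Rightarrow> 'a::euclidean_space set \<Rightarrow> 'a set" where
  "spherical_hull_nbhd \<epsilon> \<sigma> =
    {y \<in> sphere 0 1. \<exists>s>0. \<exists>z\<in>convex hull \<sigma>. norm (s *\<^sub>R y - z) < \<epsilon>}"

lemma spherical_hull_nbhd_mono:
  "\<tau> \<subseteq> \<sigma> \<Longrightarrow> spherical_hull_nbhd \<epsilon> \<tau> \<subseteq> spherical_hull_nbhd \<epsilon> \<sigma>"
  using hull_mono[of \<tau> \<sigma> convex] by (fastforce simp: spherical_hull_nbhd_def)

lemma subset_spherical_hull_nbhd:
  assumes "\<sigma> \<subseteq> sphere 0 1" "\<epsilon> > 0"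
  shows "\<sigma> \<subseteq> spherical_hull_nbhd \<epsilon> \<sigma>"
proof
  fix x assume "x \<in> \<sigma>"
  then show "x \<in> spherical_hull_nbhd \<epsilon> \<sigma>"
    using assms hull_inc[of x \<sigma> convex]
    by (auto simp: spherical_hull_nbhd_def intro!: exI[of _ "1::real"] bexI[of _ x])
qed

text \<open>Divided by \<open>T = a / s + b\<close>, the vector becomes a convex combination of
  \<open>s *\<^sub>R y\<close> and \<open>q\<close>. The same combination of \<open>z\<close> and
  \<open>q\<close> lies in the hull, and the error shrinks by the factor
  \<open>a / s / T \<le> 1\<close>.\<close>

lemma spherical_hull_nbhd_sgn:
  assumes y: "y \<in> spherical_hull_nbhd \<epsilon> \<sigma>" and q: "q \<in> convex hull \<sigma>"
    and ab: "0 \<le> a" "0 \<le> b" "a *\<^sub>R y + b *\<^sub>R q \<noteq> 0"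
  shows "sgn (a *\<^sub>R y + b *\<^sub>R q) \<in> spherical_hull_nbhd \<epsilon> \<sigma>"
proof -
  define w where "w = a *\<^sub>R y + b *\<^sub>R q"
  obtain s z where s: "s > 0" "z \<in> convex hull \<sigma>" "norm (s *\<^sub>R y - z) < \<epsilon>"
    using y by (auto simp: spherical_hull_nbhd_def)
  define T where "T = a / s + b"
  have T: "T > 0"
  proof -
    have "a \<noteq> 0 \<or> b \<noteq> 0"
      using ab(3) by auto
    then show ?thesis
      using ab(1,2) s(1) by (auto simp: T_def intro: add_pos_nonneg add_nonneg_pos)
  qed
  have w: "w \<noteq> 0"
    using ab(3) by (simp add: w_def)
  define z' where "z' = (a / s / T) *\<^sub>R z + (b / T) *\<^sub>R q"
  have "z' \<in> convex hull \<sigma>"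
    unfolding z'_def
  proof (rule convexD[OF convex_convex_hull s(2) q])
    show "a / s / T + b / T = 1"
      unfolding add_divide_distrib[symmetric] T_def[symmetric] using T by simp
  qed (use ab s(1) T in auto)
  moreover have "(norm w / T) *\<^sub>R sgn w - z' = (a / s / T) *\<^sub>R (s *\<^sub>R y - z)"
  proof -
    have "(norm w / T) *\<^sub>R sgn w = (1 / T) *\<^sub>R w"
      using w by (simp add: sgn_div_norm)
    also have "\<dots> = (a / s / T) *\<^sub>R s *\<^sub>R y + (b / T) *\<^sub>R q"
      using s(1) by (simp add: w_def scaleR_add_right)
    finally show ?thesis
      by (simp add: z'_def scaleR_diff_right)
  qed
  moreover have "norm ((a / s / T) *\<^sub>R (s *\<^sub>R y - z)) < \<epsilon>"
  proof -
    have "a / s / T \<le> 1"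
      using T ab(2) by (subst divide_le_eq_1_pos) (simp_all add: T_def)
    moreover have "0 \<le> a / s / T"
      using T ab(1) s(1) by simp
    ultimately have "norm ((a / s / T) *\<^sub>R (s *\<^sub>R y - z)) \<le> norm (s *\<^sub>R y - z)"
      by (simp only: norm_scaleR abs_of_nonneg mult_left_le_one_le norm_ge_zero)
    then show ?thesis
      using s(3) by simp
  qed
  ultimately have "z' \<in> convex hull \<sigma>" "norm ((norm w / T) *\<^sub>R sgn w - z') < \<epsilon>"
    by simp_all
  moreover have "norm w / T > 0" "sgn w \<in> sphere 0 1"
    using w T by (auto simp: norm_sgn)
  ultimately show ?thesis
    unfolding spherical_hull_nbhd_def w_def[symmetric] by blast
qed

text \<open>Replacing \<open>s *\<^sub>R y\<close> by the nearby hull point \<open>z\<close> changes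
  the inner product with \<open>q\<close> by less than \<open>\<epsilon> * norm q\<close>, which
  cannot use up the lower bound \<open>(norm q)\<^sup>2\<close>.\<close>

lemma spherical_hull_nbhd_inner_pos:
  assumes y: "y \<in> spherical_hull_nbhd \<epsilon> \<sigma>"
    and q: "\<And>z. z \<in> convex hull \<sigma> \<Longrightarrow> (norm q)\<^sup>2 \<le> z \<bullet> q" "q \<noteq> 0" "\<epsilon> \<le> norm q"
  shows "0 < y \<bullet> q"
proof -
  obtain s z where s: "s > 0" "z \<in> convex hull \<sigma>" "norm (s *\<^sub>R y - z) < \<epsilon>"
    using y by (auto simp: spherical_hull_nbhd_def)
  have "\<bar>(s *\<^sub>R y - z) \<bullet> q\<bar> \<le> norm (s *\<^sub>R y - z) * norm q"
    by (rule Cauchy_Schwarz_ineq2)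
  also have "\<dots> < norm q * norm q"
    using s(3) q(2,3) by (intro mult_strict_right_mono) auto
  finally have "s * (y \<bullet> q) - z \<bullet> q > - (norm q)\<^sup>2"
    by (simp add: inner_diff_left power2_eq_square)
  then have "s * (y \<bullet> q) > 0"
    using q(1)[OF s(2)] by simp
  then show ?thesis
    using s(1) by (simp add: zero_less_mult_iff)
qed

text \<open>Stands for the Vietoris-Rips complex with \<open>c = cos r\<close>: inner products,
  unlike angles, are bilinear and fit the linear flow.\<close>

definition sphere_rips :: "real \<Rightarrow> 'a::euclidean_space set set" where
  "sphere_rips c = {\<sigma>. \<sigma> \<noteq> {} \<and> finite \<sigma> \<and> \<sigma> \<subseteq> sphere 0 1 \<and> (\<forall>x\<in>\<sigma>. \<forall>y\<in>\<sigma>. c < x \<bullet> y)}"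

lemma vietoris_rips_geodesic_sphere:
  assumes "0 < r" "r \<le> pi"
  shows "vietoris_rips r (geodesic_sphere :: 'a::euclidean_space metric) = sphere_rips (cos r)"
proof -
  have "mdiameter geodesic_sphere \<sigma> < r \<longleftrightarrow> (\<forall>x\<in>\<sigma>. \<forall>y\<in>\<sigma>. cos r < x \<bullet> y)"
    if \<sigma>: "finite \<sigma>" "\<sigma> \<noteq> {}" "\<sigma> \<subseteq> sphere (0::'a) 1" for \<sigma>
  proof -
    have "mdist geodesic_sphere x y < r \<longleftrightarrow> cos r < x \<bullet> y" if "x \<in> \<sigma>" "y \<in> \<sigma>" for x y
    proof -
      have xy: "x \<in> sphere 0 1" "y \<in> sphere 0 1"
        using that \<sigma>(3) by auto
      have b: "- 1 \<le> x \<bullet> y" "x \<bullet> y \<le> 1"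
        using inner_sphere_bounds[OF xy] by auto
      have "arccos (x \<bullet> y) < r \<longleftrightarrow> cos r < cos (arccos (x \<bullet> y))"
        using assms b by (intro cos_mono_less_eq[symmetric]) (auto simp: arccos_lbound arccos_ubound)
      then show ?thesis
        using b by (simp add: mdist_geodesic_sphere[OF xy])
    qed
    then show ?thesis
      using mdiameter_less_iff[OF \<sigma>(1,2)] by auto
  qed
  then show ?thesis
    by (auto simp: vietoris_rips_def sphere_rips_def)
qed

lemma abstract_simplicial_complex_sphere_rips: "abstract_simplicial_complex (sphere_rips c)"
  unfolding abstract_simplicial_complex_def sphere_rips_def
  by (blast intro: finite_subset)

section \<open>The flow towards a point, cut into contiguous steps\<close>

lemma flow_nonzero:
  fixes x q :: "'a::real_inner"
  assumes "norm q = 1" "0 < x \<bullet> q" "t \<in> {0..1}"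
  shows "(1 - t) *\<^sub>R x + t *\<^sub>R q \<noteq> 0"
proof -
  have "((1 - t) *\<^sub>R x + t *\<^sub>R q) \<bullet> q = (1 - t) * (x \<bullet> q) + t"
    using assms(1) by (simp add: inner_add_left dot_square_norm)
  moreover have "(1 - t) * (x \<bullet> q) + t > 0"
    using assms(2,3) by (cases "t = 1") (auto intro: add_pos_nonneg)
  ultimately show ?thesis
    by auto
qed

text \<open>Each flow line is uniformly continuous on the compact time interval, and finitely many
  eventual conditions on \<open>N\<close> hold together.\<close>

lemma uniform_flow_step:
  fixes q :: "'a::real_inner"
  assumes q: "norm q = 1" and V: "finite V" "\<And>v. v \<in> V \<Longrightarrow> 0 < v \<bullet> q" and \<kappa>: "\<kappa> > 0"
  obtains N :: nat where "N > 0"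
    "\<And>v s t. v \<in> V \<Longrightarrow> s \<in> {0..1} \<Longrightarrow> t \<in> {0..1} \<Longrightarrow> \<bar>s - t\<bar> \<le> 1 / real N \<Longrightarrow>
      norm (sgn ((1 - s) *\<^sub>R v + s *\<^sub>R q) - sgn ((1 - t) *\<^sub>R v + t *\<^sub>R q)) < \<kappa>"
proof -
  define h where "h v t = sgn ((1 - t) *\<^sub>R v + t *\<^sub>R q)" for v and t :: real
  have "\<forall>\<^sub>F N in sequentially. \<forall>s\<in>{0..1}. \<forall>t\<in>{0..1}. \<bar>s - t\<bar> \<le> 1 / real N \<longrightarrow> norm (h v s - h v t) < \<kappa>"
    if v: "v \<in> V" for v
  proof -
    have "continuous_on {0..1} (h v)"
      unfolding h_def using flow_nonzero[OF q V(2)[OF v]] by (intro continuous_intros) auto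
    then have "uniformly_continuous_on {0..1} (h v)"
      by (simp add: compact_uniformly_continuous)
    then obtain \<delta> where \<delta>: "\<delta> > 0"
        "\<And>s t. s \<in> {0..1} \<Longrightarrow> t \<in> {0..1} \<Longrightarrow> dist t s < \<delta> \<Longrightarrow> dist (h v t) (h v s) < \<kappa>"
      unfolding uniformly_continuous_on_def using \<kappa> by metis
    have "\<forall>\<^sub>F N in sequentially. 1 / real N < \<delta>"
      using \<delta>(1) lim_1_over_n[where 'a = real] by (intro order_tendstoD(2)[where y = 0]) auto
    then show ?thesis
      by eventually_elim (use \<delta>(2) in \<open>auto simp: dist_norm\<close>)
  qed
  then have "\<forall>\<^sub>F N in sequentially. \<forall>v\<in>V. \<forall>s\<in>{0..1}. \<forall>t\<in>{0..1}. \<bar>s - t\<bar> \<le> 1 / real N \<longrightarrow> norm (h v s - h v t) < \<kappa>"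
    using V(1) by (intro eventually_ball_finite) auto
  then have "\<forall>\<^sub>F N in sequentially. N > 0 \<and> (\<forall>v\<in>V. \<forall>s\<in>{0..1}. \<forall>t\<in>{0..1}. \<bar>s - t\<bar> \<le> 1 / real N \<longrightarrow> norm (h v s - h v t) < \<kappa>)"
    using eventually_gt_at_top[of "0::nat"] by (rule eventually_conj[rotated])
  then obtain N where "N > 0 \<and> (\<forall>v\<in>V. \<forall>s\<in>{0..1}. \<forall>t\<in>{0..1}. \<bar>s - t\<bar> \<le> 1 / real N \<longrightarrow> norm (h v s - h v t) < \<kappa>)"
    using eventually_happens trivial_limit_sequentially by blast
  then show ?thesis
    using that[of N] unfolding h_def by blast
qed

text \<open>Every point of the neighbourhood makes an acute angle with \<open>q\<close>, so the flow
  towards \<open>q\<close> preserves adjacency at equal times. Contiguity also compares adjacent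
  times; finiteness of \<open>V\<close> provides a margin \<open>\<kappa>\<close> that pays for one
  short step.\<close>

lemma finitely_nullhomotopic_spherical_hull_nbhd:
  fixes \<sigma> :: "'a::euclidean_space set"
  assumes q: "q \<in> convex hull \<sigma>" "q \<noteq> 0" "\<epsilon> \<le> norm q"
    "\<And>z. z \<in> convex hull \<sigma> \<Longrightarrow> (norm q)\<^sup>2 \<le> z \<bullet> q"
  shows "finitely_nullhomotopic_in (sphere_rips c) (spherical_hull_nbhd \<epsilon> \<sigma>)"
  unfolding finitely_nullhomotopic_in_def
proof (intro allI impI, elim conjE)
  let ?C = "spherical_hull_nbhd \<epsilon> \<sigma>"
  fix V assume V: "finite V" "V \<subseteq> ?C"
  define q' where "q' = sgn q"
  have q': "norm q' = 1"
    using q(2) by (simp add: q'_def norm_sgn)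
  have unit: "norm v = 1" and pos: "0 < v \<bullet> q'" if "v \<in> V" for v
  proof -
    show "norm v = 1"
      using that V(2) by (auto simp: spherical_hull_nbhd_def)
    show "0 < v \<bullet> q'"
      using spherical_hull_nbhd_inner_pos[of v \<epsilon> \<sigma> q] that V(2) q by (auto simp: q'_def sgn_div_norm)
  qed
  \<comment> \<open>The inserted 1 keeps the minimum defined and positive when no two members of
    \<open>V\<close> are adjacent, not even a point with itself.\<close>
  define M where "M = insert 1 ((\<lambda>(v, w). v \<bullet> w - c) ` {(v, w) \<in> V \<times> V. c < v \<bullet> w})"
  have M: "finite M" "\<And>m. m \<in> M \<Longrightarrow> 0 < m" "M \<noteq> {}"
    using V(1) by (auto simp: M_def intro: finite_subset[of _ "V \<times> V"])
  define \<kappa> where "\<kappa> = Min M"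
  have \<kappa>: "\<kappa> > 0" "\<And>v w. v \<in> V \<Longrightarrow> w \<in> V \<Longrightarrow> c < v \<bullet> w \<Longrightarrow> c + \<kappa> \<le> v \<bullet> w"
  proof -
    show "\<kappa> > 0"
      unfolding \<kappa>_def using M by simp
    show "c + \<kappa> \<le> v \<bullet> w" if "v \<in> V" "w \<in> V" "c < v \<bullet> w" for v w
    proof -
      have "v \<bullet> w - c \<in> M"
        using that by (auto simp: M_def)
      then have "\<kappa> \<le> v \<bullet> w - c"
        unfolding \<kappa>_def by (rule Min_le[OF M(1)])
      then show ?thesis
        by simp
    qed
  qed
  obtain N where N: "N > 0"
    "\<And>v s t. v \<in> V \<Longrightarrow> s \<in> {0..1} \<Longrightarrow> t \<in> {0..1} \<Longrightarrow> \<bar>s - t\<bar> \<le> 1 / real N \<Longrightarrow>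
      norm (sgn ((1 - s) *\<^sub>R v + s *\<^sub>R q') - sgn ((1 - t) *\<^sub>R v + t *\<^sub>R q')) < \<kappa>"
    using uniform_flow_step[OF q' V(1) pos \<kappa>(1)] by blast
  define \<phi> where "\<phi> i v = sgn ((1 - real i / real N) *\<^sub>R v + (real i / real N) *\<^sub>R q')" for i v
  have in01: "real i / real N \<in> {0..1}" if "i \<le> N" for i
    using that N(1) by simp
  have nz: "(1 - real i / real N) *\<^sub>R v + (real i / real N) *\<^sub>R q' \<noteq> 0" if "i \<le> N" "v \<in> V" for i v
    using flow_nonzero[OF q' pos[OF that(2)] in01[OF that(1)]] .
  have \<phi>C: "\<phi> i v \<in> ?C" if "i \<le> N" "v \<in> V" for i v
  proof -
    \<comment> \<open>The flow aims at the unit vector \<open>q'\<close>, whereas the convexity of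
      the neighbourhood is stated for the hull point \<open>q\<close>; the norm moves into the
      coefficient.\<close>
    have "(1 - real i / real N) *\<^sub>R v + (real i / real N) *\<^sub>R q'
        = (1 - real i / real N) *\<^sub>R v + (real i / real N / norm q) *\<^sub>R q"
      by (simp add: q'_def sgn_div_norm divide_inverse)
    then show ?thesis
      unfolding \<phi>_def using nz[OF that] in01[OF that(1)] V(2) that(2)
      by (auto intro!: spherical_hull_nbhd_sgn q(1))
  qed
  \<comment> \<open>At equal times the inner product is at least \<open>c + \<kappa>\<close>; moving
    one unit vector by less than \<open>\<kappa>\<close> lowers it by less than
    \<open>\<kappa>\<close>.\<close>
  have close: "c < \<phi> i v \<bullet> \<phi> j w"
    if ij: "i \<le> N" "j \<le> N" "\<bar>real i - real j\<bar> \<le> 1" and vw: "v \<in> V" "w \<in> V" "c < v \<bullet> w" for i j v w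
  proof -
    have "\<bar>real j / real N - real i / real N\<bar> = \<bar>real i - real j\<bar> / real N"
      using N(1) by (simp add: abs_minus_commute flip: diff_divide_distrib)
    then have "\<bar>real j / real N - real i / real N\<bar> \<le> 1 / real N"
      using ij(3) N(1) by (simp add: divide_right_mono)
    then have "norm (\<phi> j w - \<phi> i w) < \<kappa>"
      unfolding \<phi>_def using N(2) vw in01 ij by blast
    moreover have "\<bar>\<phi> i v \<bullet> (\<phi> j w - \<phi> i w)\<bar> \<le> norm (\<phi> i v) * norm (\<phi> j w - \<phi> i w)"
      by (rule Cauchy_Schwarz_ineq2)
    moreover have "norm (\<phi> i v) = 1"
      using nz[OF ij(1) vw(1)] by (simp add: \<phi>_def norm_sgn)
    moreover have "v \<bullet> w \<le> \<phi> i v \<bullet> \<phi> i w"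
      unfolding \<phi>_def by (rule inner_sgn_flow_ge) (use vw unit pos q' in01 ij in auto)
    ultimately show ?thesis
      using \<kappa>(2)[OF vw] by (simp add: inner_diff_right)
  qed
  show "\<exists>F W c'. finite W \<and> W \<subseteq> ?C \<and>
      continuous_on ({0..1::real} \<times> polyhedron_on (sphere_rips c) V) F \<and>
      F ` ({0..1} \<times> polyhedron_on (sphere_rips c) V) \<subseteq> polyhedron_on (sphere_rips c) W \<and>
      (\<forall>p\<in>polyhedron_on (sphere_rips c) V. F (0, p) = p \<and> F (1, p) = c')"
  proof (rule contiguous_chain_nullhomotopic[OF abstract_simplicial_complex_sphere_rips V(1) N(1)])
    show "\<phi> 0 v = v" if "v \<in> V" for v
      using unit[OF that] by (simp add: \<phi>_def sgn_div_norm)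
    show "\<phi> N v = q'" if "v \<in> V" for v
      using N(1) q' by (simp add: \<phi>_def sgn_div_norm)
    fix \<tau> i assume \<tau>: "\<tau> \<in> sphere_rips c" "\<tau> \<subseteq> V" and i: "i < N"
    have "\<phi> j v \<in> sphere 0 1" if "j \<le> N" "v \<in> V" for j v
      using nz[OF that] by (simp add: \<phi>_def norm_sgn)
    moreover have "c < \<phi> k v \<bullet> \<phi> l w" if "v \<in> \<tau>" "w \<in> \<tau>" "k \<in> {i, Suc i}" "l \<in> {i, Suc i}" for k l v w
      by (rule close) (use that \<tau> i in \<open>auto simp: sphere_rips_def\<close>)
    ultimately show "\<phi> i ` \<tau> \<union> \<phi> (Suc i) ` \<tau> \<in> sphere_rips c"
      using \<tau> i unfolding sphere_rips_def by (auto simp: subset_iff)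
  qed (fact \<phi>C)
qed

section \<open>Maps between the complex and the sphere\<close>

text \<open>Summing over the support gives one function on the whole complex, independent of the
  simplex in which a point is viewed.\<close>

definition barycenter :: "('a::real_vector \<Rightarrow> real) \<Rightarrow> 'a" where
  "barycenter p = (\<Sum>v\<in>support p. p v *\<^sub>R v)"

lemma barycenter_eq:
  assumes "p \<in> closed_simplex \<sigma>"
  shows "barycenter p = (\<Sum>v\<in>\<sigma>. p v *\<^sub>R v)"
  unfolding barycenter_def
  using support_closed_simplex(1)[OF assms] finite_if_in_closed_simplex[OF assms]
  by (intro sum.mono_neutral_left) (auto simp: support_def)

lemma barycenter_in_convex_hull:
  assumes "p \<in> closed_simplex \<sigma>"
  shows "barycenter p \<in> convex hull \<sigma>"
  unfolding barycenter_eq[OF assms]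
  using assms finite_if_in_closed_simplex[OF assms] hull_inc[of _ \<sigma> convex]
  by (intro convex_sum convex_convex_hull) (auto simp: closed_simplex_def)

lemma continuous_on_barycenter:
  fixes \<sigma> :: "'a::real_normed_vector set"
  shows "continuous_on (closed_simplex \<sigma>) barycenter"
proof -
  have "continuous_on (closed_simplex \<sigma>) (\<lambda>p. p v)" for v :: 'a
    using continuous_on_product_coordinates by (rule continuous_on_subset) simp
  then have "continuous_on (closed_simplex \<sigma>) (\<lambda>p. \<Sum>v\<in>\<sigma>. p v *\<^sub>R v)"
    by (intro continuous_on_sum continuous_on_scaleR continuous_on_const)
  then show ?thesis
    by (rule continuous_on_eq) (simp add: barycenter_eq)
qed

section \<open>Partition of unity on a net\<close>

definition net_weight :: "real \<Rightarrow> 'a::metric_space \<Rightarrow> 'a \<Rightarrow> real" where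
  "net_weight \<epsilon> x v = max 0 (\<epsilon> - dist x v)"

text \<open>The partition of unity of the \<open>\<epsilon>\<close>-balls around the net, read as
  barycentric coordinates; \<open>of_bool\<close> makes it vanish off the net.\<close>

definition net_coordinates :: "real \<Rightarrow> 'a::metric_space set \<Rightarrow> 'a \<Rightarrow> 'a \<Rightarrow> real" where
  "net_coordinates \<epsilon> T x = (\<lambda>v. of_bool (v \<in> T) * net_weight \<epsilon> x v / sum (net_weight \<epsilon> x) T)"

lemma net_coordinates:
  assumes T: "finite T" "S \<subseteq> (\<Union>v\<in>T. ball v \<epsilon>)" and x: "x \<in> S"
  shows "net_coordinates \<epsilon> T x \<in> closed_simplex {v \<in> T. dist x v < \<epsilon>}"
    and "support (net_coordinates \<epsilon> T x) = {v \<in> T. dist x v < \<epsilon>}"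
    and "sum (net_weight \<epsilon> x) T > 0"
proof -
  obtain v where "v \<in> T" "dist x v < \<epsilon>"
    using T(2) x by (force simp: dist_commute)
  then have "net_weight \<epsilon> x v > 0"
    by (simp add: net_weight_def)
  then show pos: "sum (net_weight \<epsilon> x) T > 0"
    using T(1) \<open>v \<in> T\<close> by (intro sum_pos2[where i = v]) (auto simp: net_weight_def)
  show "support (net_coordinates \<epsilon> T x) = {v \<in> T. dist x v < \<epsilon>}"
    using pos by (auto simp: support_def net_coordinates_def net_weight_def max_def)
  have "(\<Sum>v\<in>{v \<in> T. dist x v < \<epsilon>}. net_coordinates \<epsilon> T x v) = (\<Sum>v\<in>T. net_coordinates \<epsilon> T x v)"
    using T(1) by (intro sum.mono_neutral_left) (auto simp: net_coordinates_def net_weight_def max_def)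
  also have "\<dots> = (\<Sum>v\<in>T. net_weight \<epsilon> x v / sum (net_weight \<epsilon> x) T)"
    by (intro sum.cong) (auto simp: net_coordinates_def)
  also have "\<dots> = 1"
    using pos by (simp flip: sum_divide_distrib)
  finally show "net_coordinates \<epsilon> T x \<in> closed_simplex {v \<in> T. dist x v < \<epsilon>}"
    using pos by (auto simp: closed_simplex_def net_coordinates_def net_weight_def max_def)
qed

lemma continuous_on_net_coordinates:
  assumes T: "finite T" "S \<subseteq> (\<Union>v\<in>T. ball v \<epsilon>)"
  shows "continuous_on S (net_coordinates \<epsilon> T)"
proof -
  have "continuous_on S (\<lambda>x. net_weight \<epsilon> x v)" for v
    unfolding net_weight_def by (intro continuous_intros)
  then show ?thesis
    unfolding net_coordinates_def
    using net_coordinates(3)[OF T]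
    by (intro continuous_on_coordinatewise_then_product continuous_on_divide continuous_on_mult
        continuous_on_const continuous_on_sum) (auto simp: less_imp_neq[symmetric])
qed

lemma inner_pos_if_dist_less_1:
  fixes x y :: "'a::euclidean_space"
  assumes "x \<in> sphere 0 1" "y \<in> sphere 0 1" "dist x y < 1"
  shows "0 < x \<bullet> y"
proof -
  have "(dist x y)\<^sup>2 < 1\<^sup>2"
    using assms(3) by (intro power_strict_mono) auto
  then show ?thesis
    using dist_sphere_power2[OF assms(1,2)] by simp
qed

theorem sphere_rips_homotopy_equivalent_sphere:
  assumes c: "- 1 / DIM('a::euclidean_space) \<le> c" "c < 1"
  shows "geometric_realization (sphere_rips c :: 'a set set) homotopy_equivalent_space top_of_set (sphere (0::'a) 1)"
proof -
  let ?K = "sphere_rips c :: 'a set set" and ?S = "sphere (0::'a) 1"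
  note K = abstract_simplicial_complex_sphere_rips[of c, where 'a = 'a]
  \<comment> \<open>The first bound keeps \<open>\<epsilon>\<close> below the distance of all hulls
    from the origin. The second makes net points within \<open>\<epsilon>\<close> of a common point
    adjacent: their squared distance is below
    \<open>4 * \<epsilon>\<^sup>2 \<le> 2 - 2 * c\<close>.\<close>
  define \<epsilon> where "\<epsilon> = min (1 / real DIM('a)) (sqrt ((1 - c) / 2))"
  have \<epsilon>: "\<epsilon> > 0" "\<epsilon> \<le> 1 / real DIM('a)" "\<epsilon> \<le> 1" "2 * \<epsilon>\<^sup>2 \<le> 1 - c"
  proof -
    show "\<epsilon> > 0" "\<epsilon> \<le> 1 / real DIM('a)"
      using c(2) by (auto simp: \<epsilon>_def)
    have "1 / real DIM('a) \<le> 1"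
      using DIM_positive[where 'a = 'a] by (simp add: Suc_le_eq)
    with \<open>\<epsilon> \<le> 1 / real DIM('a)\<close> show "\<epsilon> \<le> 1"
      by (rule order_trans)
    have "\<epsilon>\<^sup>2 \<le> (sqrt ((1 - c) / 2))\<^sup>2"
      using \<open>\<epsilon> > 0\<close> by (intro power_mono) (auto simp: \<epsilon>_def)
    then show "2 * \<epsilon>\<^sup>2 \<le> 1 - c"
      using c(2) by simp
  qed
  obtain T where T: "finite T" "T \<subseteq> ?S" "?S \<subseteq> (\<Union>v\<in>T. ball v \<epsilon>)"
  proof (rule compactE_image[OF compact_sphere])
    show "?S \<subseteq> (\<Union>v\<in>?S. ball v \<epsilon>)"
      using \<epsilon>(1) by (auto intro: centre_in_ball[THEN iffD2])
  qed auto
  define f where "f p = sgn (barycenter p)" for p :: "'a \<Rightarrow> real"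
  define g where "g = net_coordinates \<epsilon> T"
  have center: "\<exists>q. q \<in> convex hull \<sigma> \<and> q \<noteq> 0 \<and> \<epsilon> \<le> norm q \<and> (\<forall>z\<in>convex hull \<sigma>. (norm q)\<^sup>2 \<le> z \<bullet> q)"
    if \<sigma>: "\<sigma> \<in> ?K" for \<sigma>
  proof -
    \<comment> \<open>Strictness comes from the simplices, as \<open>c\<close> itself may equal the
      bound.\<close>
    have "- 1 / real DIM('a) < x \<bullet> y" if "x \<in> \<sigma>" "y \<in> \<sigma>" for x y
      using \<sigma> that c(1) by (fastforce simp: sphere_rips_def)
    then obtain q where "q \<in> convex hull \<sigma>" "1 / real DIM('a) \<le> norm q"
        "\<And>z. z \<in> convex hull \<sigma> \<Longrightarrow> (norm q)\<^sup>2 \<le> z \<bullet> q"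
      using convex_hull_separated_from_0[of \<sigma>] \<sigma> by (auto simp: sphere_rips_def)
    then show ?thesis
      using \<epsilon>(1,2) by (intro exI[of _ q]) auto
  qed
  have bary_nz: "barycenter p \<noteq> 0" if \<sigma>p: "\<sigma> \<in> ?K" "p \<in> closed_simplex \<sigma>" for \<sigma> p
  proof -
    obtain q where "q \<noteq> 0" "\<forall>z\<in>convex hull \<sigma>. (norm q)\<^sup>2 \<le> z \<bullet> q"
      using center[OF \<sigma>p(1)] by blast
    then have "(norm q)\<^sup>2 \<le> barycenter p \<bullet> q" "(norm q)\<^sup>2 > 0"
      using barycenter_in_convex_hull[OF \<sigma>p(2)] by auto
    then show ?thesis
      by auto
  qed
  have f_cont: "continuous_on (closed_simplex \<sigma>) f" and f_S: "f ` closed_simplex \<sigma> \<subseteq> ?S"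
    if \<sigma>: "\<sigma> \<in> ?K" for \<sigma>
  proof -
    show "continuous_on (closed_simplex \<sigma>) f"
      unfolding f_def using bary_nz[OF \<sigma>] by (intro continuous_on_sgn continuous_on_barycenter) auto
    show "f ` closed_simplex \<sigma> \<subseteq> ?S"
      using bary_nz[OF \<sigma>] by (auto simp: f_def norm_sgn)
  qed
  have near: "{v \<in> T. dist x v < \<epsilon>} \<in> ?K" if x: "x \<in> ?S" for x
  proof -
    have "c < v \<bullet> w" if "v \<in> T" "w \<in> T" "dist x v < \<epsilon>" "dist x w < \<epsilon>" for v w
    proof -
      have "dist v w < 2 * \<epsilon>"
        using dist_triangle3[of v w x] that(3,4) by simp
      then have "(dist v w)\<^sup>2 < (2 * \<epsilon>)\<^sup>2"
        by (intro power_strict_mono) auto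
      moreover have "v \<in> ?S" "w \<in> ?S"
        using that(1,2) T(2) by blast+
      ultimately show ?thesis
        using dist_sphere_power2[of v w] \<epsilon>(4) by (simp add: power_mult_distrib)
    qed
    moreover have "{v \<in> T. dist x v < \<epsilon>} \<noteq> {}"
      using T(3) x by (force simp: dist_commute)
    ultimately show ?thesis
      using T(1,2) by (auto simp: sphere_rips_def)
  qed
  have g_simplex: "g x \<in> closed_simplex {v \<in> T. dist x v < \<epsilon>}"
    and g_support: "support (g x) = {v \<in> T. dist x v < \<epsilon>}" if "x \<in> ?S" for x
    using net_coordinates[OF T(1,3) that] by (auto simp: g_def)
  have g_poly: "g x \<in> polyhedron_on ?K {v \<in> T. dist x v < \<epsilon>}" if "x \<in> ?S" for x
    using g_simplex[OF that] closed_simplex_eq_polyhedron_on[OF K near[OF that]] by simp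
  have g_cont: "continuous_on ?S g"
    unfolding g_def by (rule continuous_on_net_coordinates[OF T(1,3)])
  have f_map: "continuous_map (geometric_realization ?K) (top_of_set ?S) f"
    unfolding continuous_map_from_geometric_realization simplex_topology_eq
    using f_cont f_S by (auto simp: continuous_map_in_subtopology image_subset_iff)
  have g_map: "continuous_map (top_of_set ?S) (geometric_realization ?K) g"
  proof (rule continuous_map_into_geometric_realization[OF K T(1) g_cont])
    show "g ` ?S \<subseteq> polyhedron_on ?K T"
      using g_poly polyhedron_on_mono[of "{v \<in> T. dist x v < \<epsilon>}" T ?K for x] by blast
  qed
  have "homotopic_with (\<lambda>_. True) (geometric_realization ?K) (geometric_realization ?K) id (g \<circ> f)"
  proof (rule carrier_homotopic_id[OF K, where C = "spherical_hull_nbhd \<epsilon>"])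
    fix \<sigma> :: "'a set" assume \<sigma>: "\<sigma> \<in> ?K"
    show "finitely_nullhomotopic_in ?K (spherical_hull_nbhd \<epsilon> \<sigma>)"
      using center[OF \<sigma>] finitely_nullhomotopic_spherical_hull_nbhd by blast
    show "\<sigma> \<subseteq> spherical_hull_nbhd \<epsilon> \<sigma>"
      using \<sigma> \<epsilon>(1) by (intro subset_spherical_hull_nbhd) (auto simp: sphere_rips_def)
    show "continuous_on (closed_simplex \<sigma>) (g \<circ> f)"
      using f_cont[OF \<sigma>] continuous_on_subset[OF g_cont f_S[OF \<sigma>]] by (rule continuous_on_compose)
    have "g (f p) \<in> polyhedron_on ?K (T \<inter> spherical_hull_nbhd \<epsilon> \<sigma>)" if p: "p \<in> closed_simplex \<sigma>" for p
    proof -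
      have fp: "f p \<in> ?S"
        using f_S[OF \<sigma>] p by blast
      define z where "z = barycenter p"
      have z: "z \<in> convex hull \<sigma>" "z \<noteq> 0"
        using barycenter_in_convex_hull[OF p] bary_nz[OF \<sigma> p] by (auto simp: z_def)
      have "convex hull \<sigma> \<subseteq> cball 0 1"
        using \<sigma> by (intro hull_minimal) (auto simp: sphere_rips_def)
      then have z1: "norm z \<le> 1"
        using z(1) by auto
      have "v \<in> spherical_hull_nbhd \<epsilon> \<sigma>" if v: "v \<in> T" "dist (f p) v < \<epsilon>" for v
      proof -
        \<comment> \<open>The scale \<open>s = norm z\<close> is chosen so that \<open>s\<close>
          times \<open>f p\<close> is the barycenter \<open>z\<close> itself; since the hull lies in
          the unit ball, scaling does not enlarge the error.\<close>
        have "norm z *\<^sub>R v - z = norm z *\<^sub>R (v - f p)"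
          using z(2) by (simp add: f_def z_def[symmetric] sgn_div_norm scaleR_diff_right)
        then have "norm (norm z *\<^sub>R v - z) = norm z * dist (f p) v"
          by (simp add: dist_norm norm_minus_commute)
        also have "\<dots> \<le> 1 * dist (f p) v"
          using z1 by (intro mult_right_mono) auto
        finally have "norm (norm z *\<^sub>R v - z) < \<epsilon>"
          using v(2) by simp
        moreover have "v \<in> ?S" "norm z > 0"
          using v(1) T(2) z(2) by auto
        ultimately show ?thesis
          using z(1) unfolding spherical_hull_nbhd_def by blast
      qed
      then have "{v \<in> T. dist (f p) v < \<epsilon>} \<subseteq> T \<inter> spherical_hull_nbhd \<epsilon> \<sigma>"
        by auto
      then show ?thesis
        using g_poly[OF fp] polyhedron_on_mono by blast
    qed
    then show "\<exists>V. finite V \<and> V \<subseteq> spherical_hull_nbhd \<epsilon> \<sigma> \<and> (g \<circ> f) ` closed_simplex \<sigma> \<subseteq> polyhedron_on ?K V"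
      using T(1) by (intro exI[of _ "T \<inter> spherical_hull_nbhd \<epsilon> \<sigma>"]) auto
  qed (rule spherical_hull_nbhd_mono)
  then have gf: "homotopic_with (\<lambda>_. True) (geometric_realization ?K) (geometric_realization ?K) (g \<circ> f) id"
    by (rule homotopic_with_symD)
  \<comment> \<open>All vertices carrying \<open>g x\<close> are within distance 1 of
    \<open>x\<close>, so each has positive inner product with \<open>x\<close>, and so has their
    convex combination.\<close>
  have fg_pos: "0 < x \<bullet> barycenter (g x)" if x: "x \<in> ?S" for x
  proof -
    have "x \<bullet> barycenter (g x) = (\<Sum>v\<in>support (g x). g x v * (x \<bullet> v))"
      by (simp add: barycenter_def inner_sum_right)
    also have "\<dots> > 0"
    proof (rule sum_pos)
      show "finite (support (g x))" "support (g x) \<noteq> {}"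
        using support_closed_simplex[OF g_simplex[OF x]] by auto
      fix v assume v: "v \<in> support (g x)"
      then have "v \<in> T" "dist x v < 1"
        using g_support[OF x] \<epsilon>(3) by auto
      then have "0 < x \<bullet> v"
        using x T(2) by (intro inner_pos_if_dist_less_1) auto
      moreover have "0 < g x v"
        using v g_simplex[OF x] by (auto simp: support_def closed_simplex_def less_le)
      ultimately show "0 < g x v * (x \<bullet> v)"
        by simp
    qed
    finally show ?thesis .
  qed
  have bary_g: "continuous_on ?S (\<lambda>x. barycenter (g x))"
  proof -
    have "g ` ?S \<subseteq> closed_simplex T"
    proof
      fix y assume "y \<in> g ` ?S"
      then obtain x where "x \<in> ?S" "y = g x"
        by blast
      then show "y \<in> closed_simplex T"
        using g_simplex[of x] closed_simplex_mono[OF T(1), of "{v \<in> T. dist x v < \<epsilon>}"] by auto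
    qed
    then show ?thesis
      by (rule continuous_on_compose2[OF continuous_on_barycenter g_cont])
  qed
  \<comment> \<open>The linear homotopy leaves the sphere but, staying in an open half-space around
    \<open>x\<close>, misses the origin; composing with the radial retraction \<open>sgn\<close>
    brings it back.\<close>
  have "homotopic_with_canon (\<lambda>_. True) ?S (- {0}) (\<lambda>x. barycenter (g x)) id"
  proof (rule homotopic_with_linear[OF bary_g])
    fix x assume x: "x \<in> ?S"
    show "closed_segment (barycenter (g x)) (id x) \<subseteq> - {0}"
    proof
      fix y assume "y \<in> closed_segment (barycenter (g x)) (id x)"
      then obtain u where u: "0 \<le> u" "u \<le> 1" "y = (1 - u) *\<^sub>R barycenter (g x) + u *\<^sub>R x"
        by (auto simp: closed_segment_def)
      have "x \<bullet> y = (1 - u) * (x \<bullet> barycenter (g x)) + u"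
        using x by (simp add: u(3) inner_add_right dot_square_norm)
      moreover have "(1 - u) * (x \<bullet> barycenter (g x)) + u > 0"
        using u fg_pos[OF x] by (cases "u = 1") (auto intro: add_pos_nonneg)
      ultimately show "y \<in> - {0}"
        by auto
    qed
  qed auto
  then have "homotopic_with_canon (\<lambda>_. True) ?S ?S (sgn \<circ> (\<lambda>x. barycenter (g x))) (sgn \<circ> id)"
    by (rule homotopic_with_compose_continuous_left) (auto intro!: continuous_intros simp: norm_sgn)
  then have "homotopic_with_canon (\<lambda>_. True) ?S ?S (f \<circ> g) id"
    by (rule homotopic_with_eq) (auto simp: f_def sgn_div_norm)
  then show ?thesis
    unfolding homotopy_equivalent_space_def using f_map g_map gf by blast
qed

theorem theorem10:
  fixes n :: nat and r :: real
  assumes "n > 0"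
    and "DIM('a::euclidean_space) = n + 1"
    and "0 < r"
    and "r \<le> arccos (- 1 / (real n + 1))"
  shows "geometric_realization (vietoris_rips r (geodesic_sphere :: 'a metric))
           homotopy_equivalent_space top_of_set (sphere (0::'a) 1)"
proof -
  have b: "- 1 \<le> - 1 / (real n + 1)" "- 1 / (real n + 1) \<le> 1"
    by (auto simp: field_simps)
  have r: "r \<le> pi"
    using assms(4) arccos_ubound[OF b] by simp
  have "cos (arccos (- 1 / (real n + 1))) \<le> cos r"
    using assms(3,4) arccos_ubound[OF b] by (intro cos_monotone_0_pi_le) auto
  then have "- 1 / real DIM('a) \<le> cos r"
    using b assms(2) by (simp add: add.commute)
  moreover have "cos r < 1"
    using cos_monotone_0_pi[of 0 r] assms(3) r by simp
  ultimately show ?thesis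
    using sphere_rips_homotopy_equivalent_sphere[of "cos r", where 'a = 'a]
      vietoris_rips_geodesic_sphere[OF assms(3) r, where 'a = 'a] by simp
qed

end
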